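(* Let $R$ be a commutative ring and let $(A,d)$ be a differential graded $R$-algebra. Suppose that the graded ring $\ker(d)$ is gr-prime and right gr-Goldie. Let $S_A$ be the set of homogeneous regular elements of $A$ and let $S_{\ker(d)}$ be the set of homogeneous elements of $\ker(d)$ that are regular in the ring $\ker(d)$. Suppose that (1) either $S_A$ is an Ore set of $A$, (2) or else $S_{\ker(d)}$ is an Ore set in $A$. Then $S_{\ker(d)}\subseteq S_A$, and hence the natural homomorphism from $A$ to the localisation at $S_A$ (in case (1)), respectively at $S_{\ker(d)}$ (in case (2)), is injective. Further, in case (1) the localisation of $(A,d)$ at $S_A$, and in case (2) the localisation of $(A,d)$ at $S_{\ker(d)}$, is a dg-simple differential graded $R$-algebra, in the sense that it has no non-zero proper two-sided dg-ideal.
   Context: A differential graded $R$-algebra $(A,d)$ is an associative unital $\mathbb Z$-graded $R$-algebra $A$ with an $R$-linear endomorphism $d$ of degree $1$, $d^2=0$, and $d(ab)=d(a)b+(-1)^{|a|}a\,d(b)$ for $a$ homogeneous. Then $\ker(d)$ is a graded subring of $A$. A two-sided dg-ideal is a graded two-sided ideal $I$ with $d(I)\subseteq I$. An element is regular if it is neither a left nor a right zero divisor. A $\mathbb Z$-graded ring $B$ is gr-prime if $IJ\neq0$ for any two non-zero graded two-sided ideals $I,J$. $B$ is right gr-Goldie if it has finite right gr-uniform dimension (it contains no infinite direct sum of non-zero graded right ideals) and satisfies the ascending chain condition on right annihilators of homogeneous elements. A multiplicatively closed set $S\subseteq A$ is an Ore set if it satisfies the right Ore condition ($\forall r\in A\,\forall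 s\in S\,\exists r'\in A\,\exists s'\in S:\ rs'=sr'$) and the left Ore condition ($\forall r\in A\,\forall s\in S\,\exists r'\in A\,\exists s'\in S:\ s'r=r's$). For an Ore set $S$ of homogeneous regular elements, the Ore localisation $A_S$ is $\mathbb Z$-graded and carries a unique dg-algebra structure for which $A\to A_S$ is a homomorphism of dg-algebras; it satisfies $d(s^{-1}b)=(-1)^{|s|+1}s^{-1}d(s)s^{-1}b+(-1)^{|s|}s^{-1}d(b)$ for homogeneous $b\in A$ and $s\in S$. *)

theory Defs
  imports "HOL-Algebra.Algebra"
begin

section \<open>Graded rings\<close>

definition homogeneous_decomposition ::
    "('a, 'm) ring_scheme \<Rightarrow> (int \<Rightarrow> 'a set) \<Rightarrow> (int \<Rightarrow> 'a) \<Rightarrow> 'a \<Rightarrow> bool" where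
  "homogeneous_decomposition B G x a \<longleftrightarrow>
     (\<forall>n. x n \<in> G n) \<and> finite {n. x n \<noteq> \<zero>\<^bsub>B\<^esub>} \<and> a = (\<Oplus>\<^bsub>B\<^esub>n\<in>{n. x n \<noteq> \<zero>\<^bsub>B\<^esub>}. x n)"

locale graded_ring = ring B for B :: "('a, 'm) ring_scheme" (structure) and G :: "int \<Rightarrow> 'a set" +
  assumes component_subgroup: "additive_subgroup (G n) B"
    and direct_sum: "a \<in> carrier B \<Longrightarrow> \<exists>!x. homogeneous_decomposition B G x a"
    and component_mult: "\<lbrakk>a \<in> G m; b \<in> G n\<rbrakk> \<Longrightarrow> a \<otimes> b \<in> G (m + n)"

definition homogeneous_elements :: "(int \<Rightarrow> 'a set) \<Rightarrow> 'a set" where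
  "homogeneous_elements G = (\<Union>n. G n)"

definition graded_subset :: "('a, 'm) ring_scheme \<Rightarrow> (int \<Rightarrow> 'a set) \<Rightarrow> 'a set \<Rightarrow> bool" where
  "graded_subset B G I \<longleftrightarrow>
     (\<forall>a\<in>I. \<exists>x. homogeneous_decomposition B (\<lambda>n. I \<inter> G n) x a)"

definition graded_ideal :: "('a, 'm) ring_scheme \<Rightarrow> (int \<Rightarrow> 'a set) \<Rightarrow> 'a set \<Rightarrow> bool" where
  "graded_ideal B G I \<longleftrightarrow> ideal I B \<and> graded_subset B G I"

definition graded_right_ideal :: "('a, 'm) ring_scheme \<Rightarrow> (int \<Rightarrow> 'a set) \<Rightarrow> 'a set \<Rightarrow> bool" where
  "graded_right_ideal B G I \<longleftrightarrow>
     additive_subgroup I B \<and> (\<forall>a\<in>I. \<forall>b\<in>carrier B. a \<otimes>\<^bsub>B\<^esub> b \<in> I) \<and> graded_subset B G I"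

definition gr_prime :: "('a, 'm) ring_scheme \<Rightarrow> (int \<Rightarrow> 'a set) \<Rightarrow> bool" where
  "gr_prime B G \<longleftrightarrow>
     (\<forall>I J. graded_ideal B G I \<and> I \<noteq> {\<zero>\<^bsub>B\<^esub>} \<and> graded_ideal B G J \<and> J \<noteq> {\<zero>\<^bsub>B\<^esub>}
        \<longrightarrow> ideal_prod B I J \<noteq> {\<zero>\<^bsub>B\<^esub>})"

definition independent_family :: "('a, 'm) ring_scheme \<Rightarrow> (nat \<Rightarrow> 'a set) \<Rightarrow> bool" where
  "independent_family B I \<longleftrightarrow>
     (\<forall>F x. finite F \<and> (\<forall>k\<in>F. x k \<in> I k) \<and> (\<Oplus>\<^bsub>B\<^esub>k\<in>F. x k) = \<zero>\<^bsub>B\<^esub>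
        \<longrightarrow> (\<forall>k\<in>F. x k = \<zero>\<^bsub>B\<^esub>))"

text \<open>Any infinite direct sum of non-zero right ideals contains a countable one, so
  sequences suffice to express finite right gr-uniform dimension.\<close>

definition finite_right_gr_uniform_dim ::
    "('a, 'm) ring_scheme \<Rightarrow> (int \<Rightarrow> 'a set) \<Rightarrow> bool" where
  "finite_right_gr_uniform_dim B G \<longleftrightarrow>
     \<not> (\<exists>I :: nat \<Rightarrow> 'a set.
          (\<forall>k. graded_right_ideal B G (I k) \<and> I k \<noteq> {\<zero>\<^bsub>B\<^esub>}) \<and> independent_family B I)"

definition right_annihilator :: "('a, 'm) ring_scheme \<Rightarrow> 'a \<Rightarrow> 'a set" where
  "right_annihilator B a = {b \<in> carrier B. a \<otimes>\<^bsub>B\<^esub> b = \<zero>\<^bsub>B\<^esub>}"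

definition acc_homogeneous_right_annihilators ::
    "('a, 'm) ring_scheme \<Rightarrow> (int \<Rightarrow> 'a set) \<Rightarrow> bool" where
  "acc_homogeneous_right_annihilators B G \<longleftrightarrow>
     (\<forall>x :: nat \<Rightarrow> 'a.
        (\<forall>i. x i \<in> homogeneous_elements G) \<and>
        (\<forall>i. right_annihilator B (x i) \<subseteq> right_annihilator B (x (Suc i)))
        \<longrightarrow> (\<exists>N. \<forall>i\<ge>N. right_annihilator B (x i) = right_annihilator B (x N)))"

definition right_gr_Goldie :: "('a, 'm) ring_scheme \<Rightarrow> (int \<Rightarrow> 'a set) \<Rightarrow> bool" where
  "right_gr_Goldie B G \<longleftrightarrow>
     finite_right_gr_uniform_dim B G \<and> acc_homogeneous_right_annihilators B G"

definition regular_element :: "('a, 'm) ring_scheme \<Rightarrow> 'a \<Rightarrow> bool" where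
  "regular_element B a \<longleftrightarrow> a \<in> carrier B \<and>
     (\<forall>b\<in>carrier B. a \<otimes>\<^bsub>B\<^esub> b = \<zero>\<^bsub>B\<^esub> \<longrightarrow> b = \<zero>\<^bsub>B\<^esub>) \<and>
     (\<forall>b\<in>carrier B. b \<otimes>\<^bsub>B\<^esub> a = \<zero>\<^bsub>B\<^esub> \<longrightarrow> b = \<zero>\<^bsub>B\<^esub>)"

definition homogeneous_regular :: "('a, 'm) ring_scheme \<Rightarrow> (int \<Rightarrow> 'a set) \<Rightarrow> 'a set" where
  "homogeneous_regular B G = {a \<in> homogeneous_elements G. regular_element B a}"


section \<open>Ore sets and localisation\<close>

locale ore_set = submonoid S A for S and A (structure) +
  assumes right_ore:
      "\<lbrakk>r \<in> carrier A; s \<in> S\<rbrakk> \<Longrightarrow> \<exists>r'\<in>carrier A. \<exists>s'\<in>S. r \<otimes> s' = s \<otimes> r'"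
    and left_ore:
      "\<lbrakk>r \<in> carrier A; s \<in> S\<rbrakk> \<Longrightarrow> \<exists>r'\<in>carrier A. \<exists>s'\<in>S. s' \<otimes> r = r' \<otimes> s"

text \<open>The localisation is described, as usual, by the natural map \<open>\<phi>\<close>: \<open>B\<close> is the ring of left
  fractions \<open>\<phi>(s)\<^sup>-\<^sup>1 \<phi>(a)\<close>, and \<open>\<phi>\<close> kills exactly the left \<open>S\<close>-torsion. For an Ore set of regular
  elements these properties hold for the construction by equivalence classes of fractions, and
  they determine \<open>(B, \<phi>)\<close> up to a unique isomorphism under \<open>A\<close>.\<close>

locale ore_localisation = A: ring A + B: ring B
  for A (structure) and S and B (structure) and \<phi> +
  assumes hom: "\<phi> \<in> ring_hom A B"
    and inverts: "s \<in> S \<Longrightarrow> \<phi> s \<in> Units B"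
    and fractions: "carrier B = {inv\<^bsub>B\<^esub> (\<phi> s) \<otimes>\<^bsub>B\<^esub> \<phi> a | s a. s \<in> S \<and> a \<in> carrier A}"
    and kernel: "a_kernel A B \<phi> = {a \<in> carrier A. \<exists>s\<in>S. s \<otimes>\<^bsub>A\<^esub> a = \<zero>\<^bsub>A\<^esub>}"


section \<open>Differential graded algebras\<close>

definition koszul_sign :: "('a, 'm) ring_scheme \<Rightarrow> int \<Rightarrow> 'a \<Rightarrow> 'a" where
  "koszul_sign B n a = (if even n then a else \<ominus>\<^bsub>B\<^esub> a)"

text \<open>\<^const>\<open>algebra\<close> of the library requires a commutative multiplication and is not
  applicable.\<close>

locale dg_algebra = module R A + graded_ring A G
  for R :: "('r, 'm) ring_scheme" and A :: "('r, 'a, 'n) module_scheme" (structure)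
    and G :: "int \<Rightarrow> 'a set" +
  fixes d :: "'a \<Rightarrow> 'a"
  assumes smult_mult_left:
      "\<lbrakk>r \<in> carrier R; a \<in> carrier A; b \<in> carrier A\<rbrakk> \<Longrightarrow> (r \<odot> a) \<otimes> b = r \<odot> (a \<otimes> b)"
    and smult_mult_right:
      "\<lbrakk>r \<in> carrier R; a \<in> carrier A; b \<in> carrier A\<rbrakk> \<Longrightarrow> a \<otimes> (r \<odot> b) = r \<odot> (a \<otimes> b)"
    and component_submodule: "submodule (G n) R A"
    and d_closed: "a \<in> carrier A \<Longrightarrow> d a \<in> carrier A"
    and d_add: "\<lbrakk>a \<in> carrier A; b \<in> carrier A\<rbrakk> \<Longrightarrow> d (a \<oplus> b) = d a \<oplus> d b"
    and d_smult: "\<lbrakk>r \<in> carrier R; a \<in> carrier A\<rbrakk> \<Longrightarrow> d (r \<odot> a) = r \<odot> d a"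
    and d_degree: "a \<in> G n \<Longrightarrow> d a \<in> G (n + 1)"
    and d_d: "a \<in> carrier A \<Longrightarrow> d (d a) = \<zero>"
    and leibniz: "\<lbrakk>a \<in> G n; b \<in> carrier A\<rbrakk> \<Longrightarrow>
      d (a \<otimes> b) = d a \<otimes> b \<oplus> koszul_sign A n (a \<otimes> d b)"

definition dg_hom ::
    "('r, 'm) ring_scheme \<Rightarrow> ('r, 'a, 'n) module_scheme \<Rightarrow> (int \<Rightarrow> 'a set) \<Rightarrow> ('a \<Rightarrow> 'a) \<Rightarrow>
     ('r, 'b, 'k) module_scheme \<Rightarrow> (int \<Rightarrow> 'b set) \<Rightarrow> ('b \<Rightarrow> 'b) \<Rightarrow> ('a \<Rightarrow> 'b) \<Rightarrow> bool" where
  "dg_hom R A G d B H \<delta> \<phi> \<longleftrightarrow>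
     \<phi> \<in> ring_hom A B \<and>
     (\<forall>r\<in>carrier R. \<forall>a\<in>carrier A. \<phi> (r \<odot>\<^bsub>A\<^esub> a) = r \<odot>\<^bsub>B\<^esub> \<phi> a) \<and>
     (\<forall>n. \<phi> ` G n \<subseteq> H n) \<and>
     (\<forall>a\<in>carrier A. \<phi> (d a) = \<delta> (\<phi> a))"

definition dg_ideal ::
    "('a, 'm) ring_scheme \<Rightarrow> (int \<Rightarrow> 'a set) \<Rightarrow> ('a \<Rightarrow> 'a) \<Rightarrow> 'a set \<Rightarrow> bool" where
  "dg_ideal A G d I \<longleftrightarrow> graded_ideal A G I \<and> d ` I \<subseteq> I"

definition dg_simple ::
    "('r, 'm) ring_scheme \<Rightarrow> ('r, 'a, 'n) module_scheme \<Rightarrow> (int \<Rightarrow> 'a set) \<Rightarrow> ('a \<Rightarrow> 'a) \<Rightarrow> bool" where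
  "dg_simple R A G d \<longleftrightarrow>
     dg_algebra R A G d \<and>
     (\<forall>I. dg_ideal A G d I \<longrightarrow> I = {\<zero>\<^bsub>A\<^esub>} \<or> I = carrier A)"

definition cocycles :: "('a, 'm) ring_scheme \<Rightarrow> ('a \<Rightarrow> 'a) \<Rightarrow> 'a set" where
  "cocycles A d = {a \<in> carrier A. d a = \<zero>\<^bsub>A\<^esub>}"

definition cocycle_ring ::
    "('a, 'm) ring_scheme \<Rightarrow> ('a \<Rightarrow> 'a) \<Rightarrow> ('a, 'm) ring_scheme" where
  "cocycle_ring A d = A\<lparr>carrier := cocycles A d\<rparr>"

definition cocycle_grading ::
    "('a, 'm) ring_scheme \<Rightarrow> (int \<Rightarrow> 'a set) \<Rightarrow> ('a \<Rightarrow> 'a) \<Rightarrow> int \<Rightarrow> 'a set" where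
  "cocycle_grading A G d = (\<lambda>n. G n \<inter> cocycles A d)"

text \<open>The grading and the differential on the localisation are the ones for which the natural
  map is a homomorphism of dg-algebras. They need not be spelled out: \<open>\<phi>(s)\<^sup>-\<^sup>1 \<phi>(a)\<close> then has
  degree \<open>|a| - |s|\<close>, and the Leibniz rule forces the value of \<open>\<delta>\<close> on it.\<close>

definition dg_localisation ::
    "('r, 'm) ring_scheme \<Rightarrow> ('r, 'a, 'n) module_scheme \<Rightarrow> (int \<Rightarrow> 'a set) \<Rightarrow> ('a \<Rightarrow> 'a) \<Rightarrow> 'a set \<Rightarrow>
     ('r, 'b, 'k) module_scheme \<Rightarrow> (int \<Rightarrow> 'b set) \<Rightarrow> ('b \<Rightarrow> 'b) \<Rightarrow> ('a \<Rightarrow> 'b) \<Rightarrow> bool" where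
  "dg_localisation R A G d S B H \<delta> \<phi> \<longleftrightarrow>
     ore_localisation A S B \<phi> \<and> dg_algebra R B H \<delta> \<and> dg_hom R A G d B H \<delta> \<phi>"

end

theory Submission
  imports Defs
begin

text \<open>
  If \<open>s\<close> is a regular element of \<open>ker(d)\<close> and \<open>s a = 0\<close>, then \<open>s d(a) = 0\<close>, hence \<open>d(a) = 0\<close> and
  \<open>a \<in> ker(d)\<close>, so \<open>a = 0\<close>; this gives the inclusion of the regular elements.

  A non-zero dg-ideal \<open>I\<close> of the localisation contracts to a non-zero graded ideal \<open>K\<close> of \<open>ker(d)\<close>:
  for \<open>0 \<noteq> a\<close> in the contraction of \<open>I\<close> to \<open>A\<close>, either \<open>d(a) \<noteq> 0\<close> lies in \<open>K\<close> or \<open>a\<close> does. It remains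
  to see that \<open>K\<close> contains a homogeneous regular element, which becomes a unit of the localisation.
  This is the graded version of Goldie's theorem, after Goodearl and Stafford. As in the ungraded
  proof one chooses uniform elements \<open>e\<^sub>1, e\<^sub>2, \<dots> \<in> K\<close> with \<open>e\<^sub>i\<^sup>2 \<noteq> 0\<close> and \<open>e\<^sub>i e\<^sub>j = 0\<close> for \<open>i < j\<close> until
  no non-zero element of \<open>K\<close> is annihilated by all of them. In order that their sum be homogeneous, the
  \<open>e\<^sub>i\<close> are first replaced by multiples \<open>e\<^sub>i w\<^sub>i\<close> of a common degree with \<open>e\<^sub>i w\<^sub>i z = 0\<close> only if
  \<open>e\<^sub>i z = 0\<close>.
\<close>

section \<open>Homogeneous components\<close>

text \<open>Only additivity is required, so that multiplication by a fixed element and the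
  differential are covered as well as ring homomorphisms.\<close>

lemma finsum_additive_map:
  assumes "ring A" "ring B" and f: "f \<in> carrier A \<rightarrow> carrier B"
    and add: "\<And>a b. a \<in> carrier A \<Longrightarrow> b \<in> carrier A \<Longrightarrow> f (a \<oplus>\<^bsub>A\<^esub> b) = f a \<oplus>\<^bsub>B\<^esub> f b"
    and "finite F" "x \<in> F \<rightarrow> carrier A"
  shows "f (finsum A x F) = finsum B (\<lambda>k. f (x k)) F"
proof -
  interpret A: ring A by fact
  interpret B: ring B by fact
  have f0: "f \<zero>\<^bsub>A\<^esub> = \<zero>\<^bsub>B\<^esub>"
    using add[of "\<zero>\<^bsub>A\<^esub>" "\<zero>\<^bsub>A\<^esub>"] f by (simp add: Pi_iff)
  show ?thesis
    using \<open>finite F\<close> \<open>x \<in> F \<rightarrow> carrier A\<close>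
  proof (induction F)
    case empty
    then show ?case by (simp add: f0)
  next
    case (insert k F)
    then have "(\<lambda>k. f (x k)) \<in> F \<rightarrow> carrier B" "f (x k) \<in> carrier B"
      using f by (auto simp: Pi_iff)
    then show ?case
      using insert by (simp add: add Pi_iff)
  qed
qed

lemma (in ring) finsum_in_additive_subgroup:
  assumes "additive_subgroup I R" "finite F" "\<And>k. k \<in> F \<Longrightarrow> x k \<in> I"
  shows "finsum R x F \<in> I"
proof -
  interpret I: additive_subgroup I R by fact
  have "x \<in> F \<rightarrow> carrier R" using assms(3) I.a_subset by auto
  with assms(2,3) show ?thesis
    by (induction F) (auto simp: Pi_iff)
qed

lemma (in ring) additive_subgroupI:
  assumes "I \<subseteq> carrier R" "\<zero> \<in> I" "\<And>a b. a \<in> I \<Longrightarrow> b \<in> I \<Longrightarrow> a \<oplus> b \<in> I"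
    "\<And>a. a \<in> I \<Longrightarrow> \<ominus> a \<in> I"
  shows "additive_subgroup I R"
  unfolding additive_subgroup_def subgroup_def
  using assms by (auto simp: a_inv_def[symmetric])

lemma (in ring) additive_subgroup_uminus:
  assumes "additive_subgroup I R" "a \<in> I"
  shows "\<ominus> a \<in> I"
  using additive_subgroup.a_subgroup[OF assms(1)] assms(2)
  by (metis a_inv_def subgroup.m_inv_closed)

section \<open>Decomposition of an element into its components\<close>

text \<open>The description is meaningful for \<open>a\<close> in the carrier, where
  \<open>direct_sum\<close> gives existence and uniqueness of the whole family.\<close>

definition hcomp :: "('a, 'm) ring_scheme \<Rightarrow> (int \<Rightarrow> 'a set) \<Rightarrow> int \<Rightarrow> 'a \<Rightarrow> 'a" where
  "hcomp B G n a = (THE x. homogeneous_decomposition B G x a) n"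

context graded_ring
begin

lemma component_closed: "a \<in> G n \<Longrightarrow> a \<in> carrier B"
  using additive_subgroup.a_subset[OF component_subgroup] by blast

lemma component_zero [simp]: "\<zero> \<in> G n"
  by (rule additive_subgroup.zero_closed[OF component_subgroup])

lemma homogeneous_elementsI: "a \<in> G n \<Longrightarrow> a \<in> homogeneous_elements G"
  by (auto simp: homogeneous_elements_def)

lemma homogeneous_closed [simp]: "a \<in> homogeneous_elements G \<Longrightarrow> a \<in> carrier B"
  by (auto simp: homogeneous_elements_def component_closed)

lemma homogeneous_mult [simp]:
  "a \<in> homogeneous_elements G \<Longrightarrow> b \<in> homogeneous_elements G \<Longrightarrow> a \<otimes> b \<in> homogeneous_elements G"
  by (auto simp: homogeneous_elements_def intro: component_mult)

text \<open>Enlarging the exact support to a finite \<open>F\<close> only adds zero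
  summands.\<close>

lemma homogeneous_decompositionI:
  assumes "finite F" "\<And>n. x n \<in> G n" "\<And>n. n \<notin> F \<Longrightarrow> x n = \<zero>" "a = (\<Oplus>n\<in>F. x n)"
  shows "homogeneous_decomposition B G x a"
proof -
  have sub: "{n. x n \<noteq> \<zero>} \<subseteq> F" using assms(3) by auto
  have "(\<Oplus>n\<in>{n. x n \<noteq> \<zero>}. x n) = (\<Oplus>n\<in>F. x n)"
    by (rule add.finprod_mono_neutral_cong_left)
      (use assms(1) sub component_closed[OF assms(2)] in auto)
  with assms finite_subset[OF sub] show ?thesis
    by (simp add: homogeneous_decomposition_def)
qed

lemma hcomp_decomposition:
  assumes "a \<in> carrier B"
  shows "homogeneous_decomposition B G (\<lambda>n. hcomp B G n a) a"
proof -
  have "hcomp B G n a = (THE x. homogeneous_decomposition B G x a) n" for n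
    by (simp add: hcomp_def)
  then show ?thesis
    using theI'[OF direct_sum[OF assms]] by simp
qed

lemma hcomp_eqI:
  assumes "a \<in> carrier B" "homogeneous_decomposition B G x a"
  shows "hcomp B G n a = x n"
  using direct_sum[OF assms(1)] assms hcomp_decomposition by metis

lemma hcomp_component: "a \<in> carrier B \<Longrightarrow> hcomp B G n a \<in> G n"
  using hcomp_decomposition unfolding homogeneous_decomposition_def by blast

lemma hcomp_homogeneous [simp]: "a \<in> carrier B \<Longrightarrow> hcomp B G n a \<in> homogeneous_elements G"
  by (blast intro: homogeneous_elementsI hcomp_component)

lemma hcomp_closed [simp]: "a \<in> carrier B \<Longrightarrow> hcomp B G n a \<in> carrier B"
  by (blast intro: component_closed hcomp_component)

lemma hcomp_sum:
  assumes "a \<in> carrier B"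
  shows "finite {n. hcomp B G n a \<noteq> \<zero>}"
    and "a = (\<Oplus>n\<in>{n. hcomp B G n a \<noteq> \<zero>}. hcomp B G n a)"
  using hcomp_decomposition[OF assms] unfolding homogeneous_decomposition_def by blast+

text \<open>The tool for passing from homogeneous to arbitrary elements: with \<open>I\<close> the
  solution set of an additive condition, only components have to be checked.\<close>

lemma in_additive_subgroup_if_hcomp:
  assumes "additive_subgroup I B" "a \<in> carrier B" "\<And>n. hcomp B G n a \<in> I"
  shows "a \<in> I"
  by (subst hcomp_sum(2)[OF assms(2)])
    (rule finsum_in_additive_subgroup[OF assms(1) hcomp_sum(1)[OF assms(2)] assms(3)])

lemma zero_if_hcomp_zero:
  assumes "a \<in> carrier B" "\<And>n. hcomp B G n a = \<zero>"
  shows "a = \<zero>"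
  by (subst hcomp_sum(2)[OF assms(1)]) (simp add: assms(2))

lemma hcomp_of_homogeneous:
  assumes "a \<in> G m"
  shows "hcomp B G n a = (if n = m then a else \<zero>)"
proof (rule hcomp_eqI)
  show "a \<in> carrier B" using assms by (rule component_closed)
  then show "homogeneous_decomposition B G (\<lambda>n. if n = m then a else \<zero>) a"
    by (intro homogeneous_decompositionI[of "{m}"]) (auto simp: assms)
qed

lemma hcomp_zero [simp]: "hcomp B G n \<zero> = \<zero>"
  using hcomp_of_homogeneous[OF component_zero, of n n] by simp

section \<open>Graded subsets and graded right ideals\<close>

lemma graded_subsetI:
  assumes "I \<subseteq> carrier B" "\<zero> \<in> I" "\<And>a n. a \<in> I \<Longrightarrow> hcomp B G n a \<in> I"
  shows "graded_subset B G I"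
  unfolding graded_subset_def
proof
  fix a assume "a \<in> I"
  then have "homogeneous_decomposition B (\<lambda>n. I \<inter> G n) (\<lambda>n. hcomp B G n a) a"
    using hcomp_decomposition[of a] assms unfolding homogeneous_decomposition_def by blast
  then show "\<exists>x. homogeneous_decomposition B (\<lambda>n. I \<inter> G n) x a" by blast
qed

lemma hcomp_in_graded_subset:
  assumes "graded_subset B G I" "I \<subseteq> carrier B" "a \<in> I"
  shows "hcomp B G n a \<in> I"
proof -
  obtain x where x: "homogeneous_decomposition B (\<lambda>n. I \<inter> G n) x a"
    using assms by (auto simp: graded_subset_def)
  then have "homogeneous_decomposition B G x a"
    by (auto simp: homogeneous_decomposition_def)
  then have "hcomp B G n a = x n"
    using assms by (intro hcomp_eqI) auto
  with x show ?thesis by (auto simp: homogeneous_decomposition_def)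
qed

lemma graded_right_idealI:
  assumes "additive_subgroup I B" "\<And>a b. a \<in> I \<Longrightarrow> b \<in> carrier B \<Longrightarrow> a \<otimes> b \<in> I"
    "\<And>a n. a \<in> I \<Longrightarrow> hcomp B G n a \<in> I"
  shows "graded_right_ideal B G I"
  unfolding graded_right_ideal_def
  using assms additive_subgroup.a_subset[OF assms(1)] additive_subgroup.zero_closed[OF assms(1)]
  by (auto intro!: graded_subsetI)

end

text \<open>An additive map of degree \<open>p\<close> sends the decomposition of \<open>a\<close>
  to one of \<open>f a\<close>, shifted by \<open>p\<close>; uniqueness identifies the components.
  It serves for multiplications, for the differential (\<open>p = 1\<close>) and for the natural map
  (\<open>p = 0\<close>).\<close>

lemma hcomp_additive_map:
  assumes "graded_ring A G" "graded_ring B H" and f: "f \<in> carrier A \<rightarrow> carrier B"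
    and add: "\<And>a b. a \<in> carrier A \<Longrightarrow> b \<in> carrier A \<Longrightarrow> f (a \<oplus>\<^bsub>A\<^esub> b) = f a \<oplus>\<^bsub>B\<^esub> f b"
    and deg: "\<And>n a. a \<in> G n \<Longrightarrow> f a \<in> H (n + p)"
    and a: "a \<in> carrier A"
  shows "hcomp B H (n + p) (f a) = f (hcomp A G n a)"
proof -
  interpret A: graded_ring A G by fact
  interpret B: graded_ring B H by fact
  have f0: "f \<zero>\<^bsub>A\<^esub> = \<zero>\<^bsub>B\<^esub>"
    using add[of "\<zero>\<^bsub>A\<^esub>" "\<zero>\<^bsub>A\<^esub>"] f by (simp add: Pi_iff)
  define F where "F = {n. hcomp A G n a \<noteq> \<zero>\<^bsub>A\<^esub>}"
  define x where "x = (\<lambda>m. f (hcomp A G (m - p) a))"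
  have F: "finite F" "a = (\<Oplus>\<^bsub>A\<^esub>n\<in>F. hcomp A G n a)"
    unfolding F_def by (rule A.hcomp_sum[OF a])+
  have "f a = f (\<Oplus>\<^bsub>A\<^esub>n\<in>F. hcomp A G n a)"
    by (rule arg_cong[OF F(2)])
  also have "\<dots> = (\<Oplus>\<^bsub>B\<^esub>n\<in>F. f (hcomp A G n a))"
    by (rule finsum_additive_map[OF A.ring_axioms B.ring_axioms f add F(1)]) (use a in auto)
  also have "\<dots> = (\<Oplus>\<^bsub>B\<^esub>n\<in>F. x (n + p))"
    by (simp add: x_def)
  also have "\<dots> = (\<Oplus>\<^bsub>B\<^esub>m\<in>(\<lambda>n. n + p) ` F. x m)"
    by (rule B.finsum_reindex[symmetric]) (use f a in \<open>auto simp: x_def inj_on_def Pi_iff\<close>)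
  finally have sum: "f a = (\<Oplus>\<^bsub>B\<^esub>m\<in>(\<lambda>n. n + p) ` F. x m)" .
  have "homogeneous_decomposition B H x (f a)"
  proof (rule B.homogeneous_decompositionI[OF _ _ _ sum])
    show "x n \<in> H n" for n
      using deg[OF A.hcomp_component[OF a, of "n - p"]] by (simp add: x_def)
    show "x n = \<zero>\<^bsub>B\<^esub>" if "n \<notin> (\<lambda>n. n + p) ` F" for n
    proof -
      have "n - p \<notin> F" using that by (metis diff_add_cancel image_eqI)
      then show ?thesis by (simp add: x_def F_def f0)
    qed
  qed (use F(1) in simp)
  then have "hcomp B H (n + p) (f a) = x (n + p)"
    using f a by (intro B.hcomp_eqI) auto
  then show ?thesis by (simp add: x_def)
qed

section \<open>Components of products\<close>

context graded_ring
begin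

lemma hcomp_mult_left:
  assumes "s \<in> G m" "a \<in> carrier B"
  shows "hcomp B G (n + m) (s \<otimes> a) = s \<otimes> hcomp B G n a"
  using component_closed[OF assms(1)] component_mult[OF assms(1)] assms(2)
  by (intro hcomp_additive_map[OF graded_ring_axioms graded_ring_axioms])
    (auto simp: r_distr add.commute)

lemma hcomp_mult_right:
  assumes "s \<in> G m" "a \<in> carrier B"
  shows "hcomp B G (n + m) (a \<otimes> s) = hcomp B G n a \<otimes> s"
  using component_closed[OF assms(1)] component_mult[OF _ assms(1)] assms(2)
  by (intro hcomp_additive_map[OF graded_ring_axioms graded_ring_axioms, where f = "\<lambda>a. a \<otimes> s"])
    (auto simp: l_distr)

lemma eqI_hcomp:
  assumes "a \<in> carrier B" "b \<in> carrier B" "\<And>n. hcomp B G n a = hcomp B G n b"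
  shows "a = b"
  by (subst hcomp_sum(2)[OF assms(1)], subst hcomp_sum(2)[OF assms(2)]) (simp only: assms(3))

text \<open>The component \<open>e\<close> of \<open>\<one>\<close> in degree 0 is a right identity
  for every component of \<open>\<one>\<close>, as comparing degrees in the product of that
  component with \<open>\<one>\<close> shows. Hence
  \<open>\<one> = \<one> \<otimes> e = e\<close>.\<close>

lemma one_degree_zero: "\<one> \<in> G 0"
proof -
  define e where "e = hcomp B G 0 \<one>"
  have e: "e \<in> G 0" "e \<in> carrier B" by (auto simp: e_def hcomp_component)
  have "\<one> = \<one> \<otimes> e"
  proof (rule eqI_hcomp)
    fix n
    have "hcomp B G n \<one> = hcomp B G n \<one> \<otimes> e"
      using hcomp_mult_left[of "hcomp B G n \<one>" n \<one> 0] hcomp_component[of \<one> n]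
      by (simp add: hcomp_of_homogeneous e_def)
    also have "\<dots> = hcomp B G n (\<one> \<otimes> e)"
      using hcomp_mult_right[OF e(1) one_closed, of n] by simp
    finally show "hcomp B G n \<one> = hcomp B G n (\<one> \<otimes> e)" .
  qed (use e in simp_all)
  with e show ?thesis by simp
qed

lemma one_homogeneous [simp]: "\<one> \<in> homogeneous_elements G"
  by (rule homogeneous_elementsI[OF one_degree_zero])

lemma hcomp_mult_left_zero:
  assumes "s \<in> homogeneous_elements G" "a \<in> carrier B" "s \<otimes> a = \<zero>"
  shows "s \<otimes> hcomp B G n a = \<zero>"
proof -
  obtain m where "s \<in> G m" using assms by (auto simp: homogeneous_elements_def)
  then have "s \<otimes> hcomp B G n a = hcomp B G (n + m) \<zero>"
    using hcomp_mult_left assms by metis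
  then show ?thesis by simp
qed

lemma hcomp_mult_right_zero:
  assumes "s \<in> homogeneous_elements G" "a \<in> carrier B" "a \<otimes> s = \<zero>"
  shows "hcomp B G n a \<otimes> s = \<zero>"
proof -
  obtain m where "s \<in> G m" using assms by (auto simp: homogeneous_elements_def)
  then have "hcomp B G n a \<otimes> s = hcomp B G (n + m) \<zero>"
    using hcomp_mult_right assms by metis
  then show ?thesis by simp
qed

end

section \<open>Regular elements in gr-prime right gr-Goldie rings\<close>

text \<open>In a vanishing sum all terms after the least index \<open>b\<close> lie in
  \<open>V (Suc b)\<close>. Hence so does the term at \<open>b\<close>, which is then zero by
  assumption.\<close>

lemma (in ring) triangular_independent:
  assumes x: "\<And>k::nat. x k \<in> carrier R" and V: "\<And>k. additive_subgroup (V k) R"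
    and xV: "\<And>k r. r \<in> carrier R \<Longrightarrow> x k \<otimes> r \<in> V k"
    and dec: "\<And>k. V (Suc k) \<subseteq> V k"
    and zero: "\<And>k r. r \<in> carrier R \<Longrightarrow> x k \<otimes> r \<in> V (Suc k) \<Longrightarrow> x k \<otimes> r = \<zero>"
    and "finite F" "\<And>k. k \<in> F \<Longrightarrow> t k \<in> carrier R" "(\<Oplus>k\<in>F. x k \<otimes> t k) = \<zero>"
  shows "\<forall>k\<in>F. x k \<otimes> t k = \<zero>"
  using assms(6-8)
\<comment> \<open>This rule inserts a new minimum, which is the index whose term has to be
  isolated.\<close>
proof (induction F rule: finite_linorder_min_induct)
  case empty
  then show ?case by simp
next
  case (insert b F)
  have anti: "V k \<subseteq> V j" if "j \<le> k" for j k
    using lift_Suc_antimono_le[of V, OF dec that] .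
  have tb: "x b \<otimes> t b \<in> carrier R" and tF: "(\<lambda>k. x k \<otimes> t k) \<in> F \<rightarrow> carrier R"
    using insert.prems(1) x by auto
  have bF: "b \<notin> F" using insert.hyps by auto
  have sum: "x b \<otimes> t b \<oplus> (\<Oplus>k\<in>F. x k \<otimes> t k) = \<zero>"
    using insert.prems(2) insert.hyps(1) bF tb tF by simp
  have "(\<Oplus>k\<in>F. x k \<otimes> t k) \<in> V (Suc b)"
  proof (rule finsum_in_additive_subgroup[OF V insert.hyps(1)])
    fix k assume "k \<in> F"
    then show "x k \<otimes> t k \<in> V (Suc b)"
      using xV[of "t k" k] anti[of "Suc b" k] insert.hyps(2) insert.prems(1)
      by (auto simp: Suc_le_eq)
  qed
  then have "\<ominus> (\<Oplus>k\<in>F. x k \<otimes> t k) \<in> V (Suc b)"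
    by (rule additive_subgroup_uminus[OF V])
  moreover have "x b \<otimes> t b = \<ominus> (\<Oplus>k\<in>F. x k \<otimes> t k)"
    using sum tb tF by (simp add: minus_equality)
  ultimately have b0: "x b \<otimes> t b = \<zero>"
    using zero[of "t b" b] insert.prems(1) by simp
  then have "(\<Oplus>k\<in>F. x k \<otimes> t k) = \<zero>"
    using sum tF by simp
  then show ?case
    using insert.IH insert.prems(1) b0 by simp
qed

context graded_ring
begin

lemma right_annihilator_subgroup:
  assumes "a \<in> carrier B"
  shows "additive_subgroup (right_annihilator B a) B"
  using assms
  by (intro additive_subgroupI) (auto simp: right_annihilator_def r_distr r_minus)

lemma mult_zero_if_hcomp:
  assumes "a \<in> carrier B" "t \<in> carrier B" "\<And>n. a \<otimes> hcomp B G n t = \<zero>"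
  shows "a \<otimes> t = \<zero>"
proof -
  have "t \<in> right_annihilator B a"
    by (rule in_additive_subgroup_if_hcomp[OF right_annihilator_subgroup])
      (use assms in \<open>auto simp: right_annihilator_def\<close>)
  then show ?thesis by (simp add: right_annihilator_def)
qed

lemma mult_zero_if_hcomp_middle:
  assumes "a \<in> carrier B" "r \<in> carrier B" "y \<in> carrier B"
    and "\<And>r. r \<in> homogeneous_elements G \<Longrightarrow> a \<otimes> r \<otimes> y = \<zero>"
  shows "a \<otimes> r \<otimes> y = \<zero>"
proof -
  have "r \<in> {r \<in> carrier B. a \<otimes> r \<otimes> y = \<zero>}"
  proof (rule in_additive_subgroup_if_hcomp)
    show "additive_subgroup {r \<in> carrier B. a \<otimes> r \<otimes> y = \<zero>} B"
      by (rule additive_subgroupI) (use assms(1,3) in \<open>auto simp: r_distr l_distr r_minus l_minus\<close>)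
  qed (use assms in auto)
  then show ?thesis by simp
qed

lemma principal_graded_right_ideal:
  assumes x: "x \<in> homogeneous_elements G"
  shows "graded_right_ideal B G ((\<otimes>) x ` carrier B)"
proof (rule graded_right_idealI)
  show "additive_subgroup ((\<otimes>) x ` carrier B) B"
  proof (rule additive_subgroupI)
    show "\<zero> \<in> (\<otimes>) x ` carrier B"
      by (rule image_eqI[of _ _ \<zero>]) (use x in auto)
    show "a \<oplus> b \<in> (\<otimes>) x ` carrier B"
      if "a \<in> (\<otimes>) x ` carrier B" "b \<in> (\<otimes>) x ` carrier B" for a b
      using that x by (auto simp: r_distr[symmetric])
    show "\<ominus> a \<in> (\<otimes>) x ` carrier B" if "a \<in> (\<otimes>) x ` carrier B" for a
      using that x by (auto simp: r_minus[symmetric])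
  qed (use x in auto)
  show "a \<otimes> b \<in> (\<otimes>) x ` carrier B" if "a \<in> (\<otimes>) x ` carrier B" "b \<in> carrier B" for a b
    using that x by (auto simp: m_assoc)
  obtain m where m: "x \<in> G m" using x by (auto simp: homogeneous_elements_def)
  show "hcomp B G n a \<in> (\<otimes>) x ` carrier B" if "a \<in> (\<otimes>) x ` carrier B" for a n
  proof -
    obtain r where r: "r \<in> carrier B" "a = x \<otimes> r"
      using \<open>a \<in> (\<otimes>) x ` carrier B\<close> by auto
    then have "hcomp B G n a = x \<otimes> hcomp B G (n - m) r"
      using hcomp_mult_left[OF m r(1), of "n - m"] by simp
    with r show ?thesis by auto
  qed
qed

text \<open>Comparing components of degree \<open>n\<close> in
  \<open>a \<otimes> r = b \<otimes> s\<close> gives an equation with homogeneous factors of degrees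
  \<open>n - k\<close> and \<open>n - l\<close>, so a trivial intersection need only be tested on
  homogeneous multiples.\<close>

lemma principal_right_ideals_meet_trivially:
  assumes "a \<in> homogeneous_elements G" "b \<in> homogeneous_elements G"
    and zero: "\<And>r s. r \<in> homogeneous_elements G \<Longrightarrow> s \<in> homogeneous_elements G \<Longrightarrow>
      a \<otimes> r = b \<otimes> s \<Longrightarrow> a \<otimes> r = \<zero>"
    and r: "r \<in> carrier B" and s: "s \<in> carrier B" and eq: "a \<otimes> r = b \<otimes> s"
  shows "a \<otimes> r = \<zero>"
proof (rule zero_if_hcomp_zero)
  fix n
  obtain k l where k: "a \<in> G k" and l: "b \<in> G l"
    using assms(1,2) by (auto simp: homogeneous_elements_def)
  have "a \<otimes> hcomp B G (n - k) r = b \<otimes> hcomp B G (n - l) s"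
    using hcomp_mult_left[OF k r, of "n - k"] hcomp_mult_left[OF l s, of "n - l"] eq by simp
  then have "a \<otimes> hcomp B G (n - k) r = \<zero>"
    by (intro zero) (use r s in auto)
  then show "hcomp B G n (a \<otimes> r) = \<zero>"
    using hcomp_mult_left[OF k r, of "n - k"] by simp
qed (use assms in auto)

text \<open>The right ideal generated by \<open>u\<close> is gr-uniform. Principal right ideals with
  homogeneous generators suffice for the test, since a non-zero graded right ideal contains a
  non-zero homogeneous element.\<close>

definition gr_uniform :: "'a \<Rightarrow> bool" where
  "gr_uniform u \<longleftrightarrow> u \<in> homogeneous_elements G \<and> u \<noteq> \<zero> \<and>
     (\<forall>r\<in>homogeneous_elements G. \<forall>s\<in>homogeneous_elements G. u \<otimes> r \<noteq> \<zero> \<longrightarrow> u \<otimes> s \<noteq> \<zero> \<longrightarrow>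
        (\<exists>r'\<in>homogeneous_elements G. \<exists>s'\<in>homogeneous_elements G.
           u \<otimes> r \<otimes> r' = u \<otimes> s \<otimes> s' \<and> u \<otimes> r \<otimes> r' \<noteq> \<zero>))"

lemma gr_uniform_homogeneous: "gr_uniform u \<Longrightarrow> u \<in> homogeneous_elements G"
  and gr_uniform_nonzero: "gr_uniform u \<Longrightarrow> u \<noteq> \<zero>"
  by (auto simp: gr_uniform_def)

lemma gr_uniform_mult:
  assumes u: "gr_uniform u" and p: "p \<in> homogeneous_elements G" and up: "u \<otimes> p \<noteq> \<zero>"
  shows "gr_uniform (u \<otimes> p)"
proof -
  have uh: "u \<in> homogeneous_elements G" by (rule gr_uniform_homogeneous[OF u])
  show ?thesis
    unfolding gr_uniform_def
  proof (intro conjI ballI impI)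
    fix r s
    assume r: "r \<in> homogeneous_elements G" and s: "s \<in> homogeneous_elements G"
      and "u \<otimes> p \<otimes> r \<noteq> \<zero>" "u \<otimes> p \<otimes> s \<noteq> \<zero>"
    then have "u \<otimes> (p \<otimes> r) \<noteq> \<zero>" "u \<otimes> (p \<otimes> s) \<noteq> \<zero>"
      using uh p by (auto simp: m_assoc)
    then obtain r' s' where rs: "r' \<in> homogeneous_elements G" "s' \<in> homogeneous_elements G"
      "u \<otimes> (p \<otimes> r) \<otimes> r' = u \<otimes> (p \<otimes> s) \<otimes> s'" "u \<otimes> (p \<otimes> r) \<otimes> r' \<noteq> \<zero>"
      using u homogeneous_mult[OF p r] homogeneous_mult[OF p s] unfolding gr_uniform_def by blast
    moreover have "u \<otimes> (p \<otimes> r) = u \<otimes> p \<otimes> r" "u \<otimes> (p \<otimes> s) = u \<otimes> p \<otimes> s"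
      using uh p r s by (simp_all add: m_assoc)
    ultimately show "\<exists>r'\<in>homogeneous_elements G. \<exists>s'\<in>homogeneous_elements G.
        u \<otimes> p \<otimes> r \<otimes> r' = u \<otimes> p \<otimes> s \<otimes> s' \<and> u \<otimes> p \<otimes> r \<otimes> r' \<noteq> \<zero>"
      by auto
  qed (use uh p up in auto)
qed

end

section \<open>Consequences of gr-primeness and of the Goldie conditions\<close>

locale gr_prime_right_Goldie_ring = graded_ring +
  assumes prime: "gr_prime B G" and Goldie: "right_gr_Goldie B G"
begin

text \<open>The elementwise form of gr-primeness: if all these products vanished, suitable
  annihilators would be non-zero graded ideals with product zero.\<close>

lemma homogeneous_middle_factor:
  assumes a: "a \<in> homogeneous_elements G" "a \<noteq> \<zero>" and b: "b \<in> homogeneous_elements G" "b \<noteq> \<zero>"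
  shows "\<exists>r\<in>homogeneous_elements G. a \<otimes> r \<otimes> b \<noteq> \<zero>"
proof (rule ccontr)
  assume *: "\<not> ?thesis"
  have ab: "a \<otimes> r \<otimes> b = \<zero>" if "r \<in> carrier B" for r
    by (rule mult_zero_if_hcomp_middle) (use that a b * in auto)
  \<comment> \<open>\<open>J\<close> is the right annihilator of the right ideal generated by
    \<open>a\<close>, and \<open>I\<close> is the left annihilator of \<open>J\<close>. Both are
    two-sided and graded, with \<open>b\<close> in \<open>J\<close> and \<open>a\<close> in
    \<open>I\<close>.\<close>
  define J where "J = {y \<in> carrier B. \<forall>r\<in>carrier B. a \<otimes> r \<otimes> y = \<zero>}"
  define I where "I = {x \<in> carrier B. \<forall>y\<in>J. x \<otimes> y = \<zero>}"
  have Jc: "J \<subseteq> carrier B" and Ic: "I \<subseteq> carrier B" by (auto simp: J_def I_def)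
  have Jsub: "additive_subgroup J B"
    by (rule additive_subgroupI) (use a in \<open>auto simp: J_def r_distr r_minus\<close>)
  have Jl: "t \<otimes> y \<in> J" if "t \<in> carrier B" "y \<in> J" for t y
  proof -
    have "a \<otimes> r \<otimes> (t \<otimes> y) = a \<otimes> (r \<otimes> t) \<otimes> y" if "r \<in> carrier B" for r
      using that \<open>t \<in> carrier B\<close> \<open>y \<in> J\<close> a Jc by (auto simp: m_assoc subset_iff)
    with that show ?thesis by (auto simp: J_def)
  qed
  have Jr: "y \<otimes> t \<in> J" if "t \<in> carrier B" "y \<in> J" for t y
    using that a by (auto simp: J_def m_assoc[symmetric])
  have "ideal J B"
    by (intro ideal.intro ideal_axioms.intro) (use Jsub Jl Jr ring_axioms in auto)
  have Jg: "hcomp B G n y \<in> J" if "y \<in> J" for n y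
  proof -
    have "a \<otimes> r \<otimes> hcomp B G n y = \<zero>" if "r \<in> carrier B" for r
      by (rule mult_zero_if_hcomp_middle)
        (use that \<open>y \<in> J\<close> a in \<open>auto simp: J_def intro!: hcomp_mult_left_zero\<close>)
    with that show ?thesis by (auto simp: J_def)
  qed
  have Isub: "additive_subgroup I B"
    by (rule additive_subgroupI) (use Jc in \<open>auto simp: I_def l_distr l_minus subset_iff\<close>)
  have Il: "t \<otimes> x \<in> I" if "t \<in> carrier B" "x \<in> I" for t x
    using that Jc by (auto simp: I_def m_assoc subset_iff)
  have Ir: "x \<otimes> t \<in> I" if "t \<in> carrier B" "x \<in> I" for t x
    using that Jc Jl by (auto simp: I_def m_assoc subset_iff)
  have "ideal I B"
    by (intro ideal.intro ideal_axioms.intro) (use Isub Il Ir ring_axioms in auto)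
  have Ig: "hcomp B G n x \<in> I" if "x \<in> I" for n x
  proof -
    have x: "x \<in> carrier B" using that Ic by auto
    have "hcomp B G n x \<otimes> y = \<zero>" if "y \<in> J" for y
    proof (rule mult_zero_if_hcomp)
      show "hcomp B G n x \<otimes> hcomp B G k y = \<zero>" for k
        using \<open>x \<in> I\<close> Jg[OF \<open>y \<in> J\<close>] Jc \<open>y \<in> J\<close>
        by (intro hcomp_mult_right_zero) (auto simp: I_def)
    qed (use x that Jc in auto)
    with x show ?thesis by (auto simp: I_def)
  qed
  have graded: "graded_ideal B G I" "graded_ideal B G J"
    unfolding graded_ideal_def
    using \<open>ideal I B\<close> \<open>ideal J B\<close> Ic Jc Ig Jg Isub Jsub
    by (auto intro!: graded_subsetI additive_subgroup.zero_closed)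
  have "b \<in> J" using b ab by (auto simp: J_def)
  have "a \<otimes> y = \<zero>" if "y \<in> J" for y
  proof -
    have "a \<otimes> \<one> \<otimes> y = \<zero>" using that one_closed unfolding J_def by blast
    then show ?thesis using a by simp
  qed
  then have "a \<in> I" using a by (auto simp: I_def)
  have "x = \<zero>" if "x \<in> ideal_prod B I J" for x
    using that by induction (auto simp: I_def)
  moreover have "\<zero> \<in> ideal_prod B I J"
    using ideal_prod.prod[OF \<open>a \<in> I\<close> \<open>b \<in> J\<close>, of B] \<open>a \<in> I\<close> \<open>b \<in> J\<close> by (auto simp: I_def)
  ultimately have "ideal_prod B I J = {\<zero>}" by blast
  moreover have "I \<noteq> {\<zero>}" "J \<noteq> {\<zero>}"
    using \<open>a \<in> I\<close> \<open>b \<in> J\<close> a(2) b(2) by auto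
  ultimately show False
    using prime graded unfolding gr_prime_def by simp
qed

text \<open>The hypothesis says that the right annihilator of \<open>z\<close> is gr-essential. If
  \<open>z\<close> is non-zero, primeness gives \<open>r\<close> with
  \<open>z \<otimes> r \<otimes> z \<noteq> \<zero>\<close>; this product has the same property and
  a strictly larger right annihilator, and iteration contradicts the ascending chain
  condition.\<close>

lemma right_gr_nonsingular:
  assumes "z \<in> homogeneous_elements G"
    and "\<And>b. b \<in> homogeneous_elements G \<Longrightarrow> b \<noteq> \<zero> \<Longrightarrow>
      \<exists>t\<in>homogeneous_elements G. b \<otimes> t \<noteq> \<zero> \<and> z \<otimes> (b \<otimes> t) = \<zero>"
  shows "z = \<zero>"
proof (rule ccontr)
  define Z where "Z = {z \<in> homogeneous_elements G. z \<noteq> \<zero> \<and>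
    (\<forall>b\<in>homogeneous_elements G. b \<noteq> \<zero> \<longrightarrow>
      (\<exists>t\<in>homogeneous_elements G. b \<otimes> t \<noteq> \<zero> \<and> z \<otimes> (b \<otimes> t) = \<zero>))}"
  assume "z \<noteq> \<zero>"
  with assms have "z \<in> Z" by (auto simp: Z_def)
  have step: "\<exists>z'. z' \<in> Z \<and> right_annihilator B z \<subset> right_annihilator B z'" if "z \<in> Z" for z
  proof -
    have z: "z \<in> homogeneous_elements G" "z \<noteq> \<zero>" using that by (auto simp: Z_def)
    obtain r where r: "r \<in> homogeneous_elements G" "z \<otimes> r \<otimes> z \<noteq> \<zero>"
      using homogeneous_middle_factor[OF z z] by auto
    have assoc: "z \<otimes> r \<otimes> z \<otimes> c = z \<otimes> r \<otimes> (z \<otimes> c)" if "c \<in> carrier B" for c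
      using z r that by (simp add: m_assoc)
    have "\<exists>t\<in>homogeneous_elements G. b \<otimes> t \<noteq> \<zero> \<and> z \<otimes> r \<otimes> z \<otimes> (b \<otimes> t) = \<zero>"
      if b: "b \<in> homogeneous_elements G" "b \<noteq> \<zero>" for b
    proof -
      obtain t where t: "t \<in> homogeneous_elements G" "b \<otimes> t \<noteq> \<zero>" "z \<otimes> (b \<otimes> t) = \<zero>"
        using \<open>z \<in> Z\<close> b by (auto simp: Z_def)
      then have "z \<otimes> r \<otimes> z \<otimes> (b \<otimes> t) = \<zero>"
        using assoc[of "b \<otimes> t"] b z r by simp
      with t show ?thesis by blast
    qed
    then have "z \<otimes> r \<otimes> z \<in> Z" using z r by (auto simp: Z_def)
    \<comment> \<open>Essentiality is applied to \<open>r \<otimes> z\<close>; the resulting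
      \<open>t\<close> shows that the annihilator grows strictly.\<close>
    moreover have "r \<otimes> z \<noteq> \<zero>" using r z by (auto simp: m_assoc)
    then obtain t where t: "t \<in> homogeneous_elements G" "r \<otimes> z \<otimes> t \<noteq> \<zero>" "z \<otimes> (r \<otimes> z \<otimes> t) = \<zero>"
      using \<open>z \<in> Z\<close> homogeneous_mult[OF r(1) z(1)] unfolding Z_def by blast
    have "z \<otimes> r \<otimes> z \<otimes> t = \<zero>" "z \<otimes> t \<noteq> \<zero>"
      using t r z by (auto simp: m_assoc)
    then have "t \<in> right_annihilator B (z \<otimes> r \<otimes> z)" "t \<notin> right_annihilator B z"
      using t by (auto simp: right_annihilator_def)
    moreover have "right_annihilator B z \<subseteq> right_annihilator B (z \<otimes> r \<otimes> z)"
      using assoc z r by (auto simp: right_annihilator_def)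
    ultimately show ?thesis by blast
  qed
  have "\<exists>f. \<forall>n. f n \<in> Z \<and> right_annihilator B (f n) \<subset> right_annihilator B (f (Suc n))"
    by (rule dependent_nat_choice) (use \<open>z \<in> Z\<close> step in auto)
  then obtain f where f: "\<And>n. f n \<in> Z"
    "\<And>n. right_annihilator B (f n) \<subset> right_annihilator B (f (Suc n))"
    by metis
  have "\<forall>i. f i \<in> homogeneous_elements G" using f(1) by (auto simp: Z_def)
  then obtain N where N: "\<forall>i\<ge>N. right_annihilator B (f i) = right_annihilator B (f N)"
    using Goldie f(2) unfolding right_gr_Goldie_def acc_homogeneous_right_annihilators_def
    by (meson psubset_imp_subset)
  show False
    using f(2)[of N] N[rule_format, of "Suc N"] by simp
qed

text \<open>The form in which finite uniform dimension is applied: the right ideals generated by the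
  \<open>x k\<close> would form an infinite direct sum. For \<open>V\<close> a chain of principal
  right ideals or of common right annihilators is taken.\<close>

lemma no_infinite_triangular_family:
  assumes x: "\<And>k::nat. x k \<in> homogeneous_elements G" "\<And>k. x k \<noteq> \<zero>"
    and V: "\<And>k. additive_subgroup (V k) B"
    and xV: "\<And>k r. r \<in> carrier B \<Longrightarrow> x k \<otimes> r \<in> V k"
    and dec: "\<And>k. V (Suc k) \<subseteq> V k"
    and zero: "\<And>k r. r \<in> carrier B \<Longrightarrow> x k \<otimes> r \<in> V (Suc k) \<Longrightarrow> x k \<otimes> r = \<zero>"
  shows False
proof -
  let ?I = "\<lambda>k. (\<otimes>) (x k) ` carrier B"
  have "graded_right_ideal B G (?I k) \<and> ?I k \<noteq> {\<zero>}" for k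
  proof
    show "graded_right_ideal B G (?I k)" by (rule principal_graded_right_ideal[OF x(1)])
    have "x k \<otimes> \<one> \<in> ?I k" by blast
    then show "?I k \<noteq> {\<zero>}" using x[of k] by auto
  qed
  moreover have "independent_family B ?I"
    unfolding independent_family_def
  proof (intro allI impI, elim conjE)
    fix F :: "nat set" and y
    assume F: "finite F" and y: "\<forall>k\<in>F. y k \<in> ?I k" and sum: "(\<Oplus>k\<in>F. y k) = \<zero>"
    then have "\<forall>k\<in>F. \<exists>t. t \<in> carrier B \<and> y k = x k \<otimes> t" by auto
    then obtain t where t: "\<forall>k\<in>F. t k \<in> carrier B \<and> y k = x k \<otimes> t k" by metis
    have "(\<Oplus>k\<in>F. x k \<otimes> t k) = (\<Oplus>k\<in>F. y k)"
      by (rule finsum_cong') (use t x(1) in auto)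
    with sum have "\<forall>k\<in>F. x k \<otimes> t k = \<zero>"
      by (intro triangular_independent[of x V]) (use V xV dec zero F t x(1) in auto)
    with t show "\<forall>k\<in>F. y k = \<zero>" by simp
  qed
  ultimately show False
    using Goldie unfolding right_gr_Goldie_def finite_right_gr_uniform_dim_def by metis
qed

end

section \<open>Uniform elements: existence, cancellation, common degrees\<close>

context gr_prime_right_Goldie_ring
begin

text \<open>If no multiple of \<open>v\<close> were uniform, each non-zero multiple \<open>w\<close>
  would have non-zero multiples \<open>w \<otimes> p\<close> and \<open>w \<otimes> q\<close> whose
  right ideals meet trivially. Setting the first aside and continuing inside the second produces an
  infinite triangular family.\<close>

lemma ex_gr_uniform_multiple:
  assumes v: "v \<in> homogeneous_elements G" "v \<noteq> \<zero>"
  shows "\<exists>r\<in>homogeneous_elements G. gr_uniform (v \<otimes> r)"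
proof (rule ccontr)
  assume no: "\<not> ?thesis"
  define W where "W = {w \<in> homogeneous_elements G. w \<noteq> \<zero> \<and> (\<exists>r\<in>homogeneous_elements G. w = v \<otimes> r)}"
  \<comment> \<open>\<open>w \<otimes> p\<close> is the part split off, and \<open>w'\<close>
    generates the part in which the construction goes on.\<close>
  define Q where "Q w p w' \<longleftrightarrow> p \<in> homogeneous_elements G \<and> w \<otimes> p \<noteq> \<zero> \<and>
    (\<exists>q\<in>homogeneous_elements G. w' = w \<otimes> q) \<and>
    (\<forall>r\<in>homogeneous_elements G. \<forall>s\<in>homogeneous_elements G. w \<otimes> p \<otimes> r = w' \<otimes> s \<longrightarrow> w \<otimes> p \<otimes> r = \<zero>)"
    for w p w'
  have step: "\<exists>w'. w' \<in> W \<and> (\<exists>p. Q w p w')" if w: "w \<in> W" for w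
  proof -
    obtain r where r: "r \<in> homogeneous_elements G" "w = v \<otimes> r" using w by (auto simp: W_def)
    have wh: "w \<in> homogeneous_elements G" "w \<noteq> \<zero>" using w by (auto simp: W_def)
    have "\<not> gr_uniform w" using no r by auto
    then obtain p q where pq: "p \<in> homogeneous_elements G" "q \<in> homogeneous_elements G"
      "w \<otimes> p \<noteq> \<zero>" "w \<otimes> q \<noteq> \<zero>"
      "\<forall>r'\<in>homogeneous_elements G. \<forall>s'\<in>homogeneous_elements G.
         w \<otimes> p \<otimes> r' = w \<otimes> q \<otimes> s' \<longrightarrow> w \<otimes> p \<otimes> r' = \<zero>"
      using wh unfolding gr_uniform_def by blast
    have "w \<otimes> q = v \<otimes> (r \<otimes> q)" using r pq v by (simp add: m_assoc)
    then have "w \<otimes> q \<in> W"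
      using homogeneous_mult[OF wh(1) pq(2)] homogeneous_mult[OF r(1) pq(2)] pq(4)
      unfolding W_def by blast
    moreover have "Q w p (w \<otimes> q)" using pq unfolding Q_def by blast
    ultimately show ?thesis by blast
  qed
  have "v \<in> W" using v by (auto simp: W_def intro!: bexI[of _ \<one>])
  have "\<exists>f. \<forall>n. f n \<in> W \<and> (\<exists>p. Q (f n) p (f (Suc n)))"
    by (rule dependent_nat_choice) (use \<open>v \<in> W\<close> step in auto)
  then obtain f where f: "\<And>n. f n \<in> W" "\<And>n. \<exists>p. Q (f n) p (f (Suc n))" by metis
  then obtain p where p: "\<And>n. Q (f n) (p n) (f (Suc n))" by metis
  have fh: "f k \<in> homogeneous_elements G" for k using f(1)[of k] by (auto simp: W_def)
  have ph: "p k \<in> homogeneous_elements G" and fp: "f k \<otimes> p k \<noteq> \<zero>" for k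
    using p[of k] by (auto simp: Q_def)
  show False
  proof (rule no_infinite_triangular_family[of "\<lambda>k. f k \<otimes> p k" "\<lambda>k. (\<otimes>) (f k) ` carrier B"])
    fix k :: nat
    show "f k \<otimes> p k \<in> homogeneous_elements G" "f k \<otimes> p k \<noteq> \<zero>"
      using fh ph fp by auto
    show "additive_subgroup ((\<otimes>) (f k) ` carrier B) B"
      using principal_graded_right_ideal[OF fh] by (auto simp: graded_right_ideal_def)
    show "f k \<otimes> p k \<otimes> r \<in> (\<otimes>) (f k) ` carrier B" if "r \<in> carrier B" for r
      using fh ph that by (auto simp: m_assoc)
    obtain q where q: "q \<in> homogeneous_elements G" "f (Suc k) = f k \<otimes> q"
      using p[of k] by (auto simp: Q_def)
    then show "(\<otimes>) (f (Suc k)) ` carrier B \<subseteq> (\<otimes>) (f k) ` carrier B"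
      using fh by (auto simp: m_assoc)
    fix r assume r: "r \<in> carrier B" "f k \<otimes> p k \<otimes> r \<in> (\<otimes>) (f (Suc k)) ` carrier B"
    then obtain s where s: "s \<in> carrier B" "f k \<otimes> p k \<otimes> r = f (Suc k) \<otimes> s" by auto
    show "f k \<otimes> p k \<otimes> r = \<zero>"
    proof (rule principal_right_ideals_meet_trivially[OF _ _ _ r(1) s])
      show "f k \<otimes> p k \<otimes> r' = \<zero>"
        if "r' \<in> homogeneous_elements G" "s' \<in> homogeneous_elements G"
          "f k \<otimes> p k \<otimes> r' = f (Suc k) \<otimes> s'" for r' s'
        using p[of k] that unfolding Q_def by blast
    qed (use fh ph in auto)
  qed
qed

text \<open>Left multiplication by a homogeneous \<open>c\<close> on a uniform right ideal is zero or injective: a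
  non-trivial kernel would be essential, which makes \<open>c \<otimes> u\<close> singular.\<close>

lemma gr_uniform_cancel:
  assumes u: "gr_uniform u" and c: "c \<in> homogeneous_elements G" and cu: "c \<otimes> u \<noteq> \<zero>"
    and t: "t \<in> carrier B" and cut: "c \<otimes> (u \<otimes> t) = \<zero>"
  shows "u \<otimes> t = \<zero>"
proof -
  have uh: "u \<in> homogeneous_elements G" by (rule gr_uniform_homogeneous[OF u])
  have hom: "u \<otimes> t = \<zero>" if th: "t \<in> homogeneous_elements G" and ct: "c \<otimes> (u \<otimes> t) = \<zero>" for t
  proof (rule ccontr)
    assume ut: "u \<otimes> t \<noteq> \<zero>"
    have "c \<otimes> u = \<zero>"
    proof (rule right_gr_nonsingular)
      fix b assume b: "b \<in> homogeneous_elements G" "b \<noteq> \<zero>"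
      show "\<exists>t\<in>homogeneous_elements G. b \<otimes> t \<noteq> \<zero> \<and> c \<otimes> u \<otimes> (b \<otimes> t) = \<zero>"
      \<comment> \<open>If \<open>u \<otimes> b = \<zero>\<close>, then \<open>b\<close> itself is
        killed. Otherwise \<open>u \<otimes> b\<close> and \<open>u \<otimes> t\<close> have a
        common non-zero multiple by uniformity, and \<open>c\<close> kills it.\<close>
      proof (cases "u \<otimes> b = \<zero>")
        case True
        have "c \<otimes> u \<otimes> (b \<otimes> \<one>) = c \<otimes> (u \<otimes> b)" using c uh b by (simp add: m_assoc)
        with True b c show ?thesis by (intro bexI[of _ \<one>]) auto
      next
        case False
        then obtain r s where rs: "r \<in> homogeneous_elements G" "s \<in> homogeneous_elements G"
          "u \<otimes> b \<otimes> r = u \<otimes> t \<otimes> s" "u \<otimes> b \<otimes> r \<noteq> \<zero>"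
          using u b(1) th ut unfolding gr_uniform_def by blast
        have "b \<otimes> r \<noteq> \<zero>" using rs uh b by (auto simp: m_assoc)
        moreover have "c \<otimes> u \<otimes> (b \<otimes> r) = c \<otimes> (u \<otimes> b \<otimes> r)"
          using c uh b rs by (simp add: m_assoc)
        moreover have "\<dots> = c \<otimes> (u \<otimes> t) \<otimes> s"
          using c uh th rs by (simp add: m_assoc)
        ultimately show ?thesis using ct rs by auto
      qed
    qed (use c uh in auto)
    with cu show False by simp
  qed
  show ?thesis
  proof (rule mult_zero_if_hcomp)
    fix n
    have "c \<otimes> u \<otimes> hcomp B G n t = \<zero>"
      using c uh t cut by (intro hcomp_mult_left_zero) (auto simp: m_assoc)
    then show "u \<otimes> hcomp B G n t = \<zero>"
      using c uh t by (intro hom) (auto simp: m_assoc)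
  qed (use uh t in auto)
qed

text \<open>For a uniform multiple \<open>u\<close> of \<open>y\<close>, primeness gives
  \<open>p\<close> with \<open>u \<otimes> p \<otimes> u \<noteq> \<zero>\<close>. Left
  multiplication by \<open>u \<otimes> p\<close> is then injective on the right ideal of
  \<open>u\<close>, so \<open>u \<otimes> p\<close> has non-zero square.\<close>

lemma ex_gr_uniform_square_nonzero:
  assumes y: "y \<in> homogeneous_elements G" "y \<noteq> \<zero>"
  shows "\<exists>t\<in>homogeneous_elements G. gr_uniform (y \<otimes> t) \<and> y \<otimes> t \<otimes> (y \<otimes> t) \<noteq> \<zero>"
proof -
  obtain r where r: "r \<in> homogeneous_elements G" and u: "gr_uniform (y \<otimes> r)"
    using ex_gr_uniform_multiple[OF y] by auto
  define u where "u = y \<otimes> r"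
  have u: "gr_uniform u" using u by (simp add: u_def)
  have uh: "u \<in> homogeneous_elements G" "u \<noteq> \<zero>"
    by (rule gr_uniform_homogeneous[OF u], rule gr_uniform_nonzero[OF u])
  obtain p where p: "p \<in> homogeneous_elements G" "u \<otimes> p \<otimes> u \<noteq> \<zero>"
    using homogeneous_middle_factor[OF uh uh] by auto
  have up: "u \<otimes> p \<noteq> \<zero>" using p uh by auto
  then have "gr_uniform (u \<otimes> p)" by (rule gr_uniform_mult[OF u p(1)])
  moreover have "u \<otimes> p \<otimes> (u \<otimes> p) \<noteq> \<zero>"
    using gr_uniform_cancel[OF u _ p(2)] uh p up by auto
  moreover have "u \<otimes> p = y \<otimes> (r \<otimes> p)" using y r p by (simp add: u_def m_assoc)
  ultimately show ?thesis using r p by (intro bexI[of _ "r \<otimes> p"]) auto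
qed

text \<open>Factors acting injectively on a common uniform right ideal can be composed in any order, and
  \<open>\<int>\<close> is commutative; so each \<open>e i\<close> can be completed by the factors attached to the other indices
  to an element whose degree does not depend on \<open>i\<close>.\<close>

lemma ex_multiples_of_equal_degree:
  assumes u: "gr_uniform u" and N: "finite N"
    and e: "\<And>i. i \<in> N \<Longrightarrow> gr_uniform (e i)" "\<And>i. i \<in> N \<Longrightarrow> e i \<otimes> e i \<noteq> \<zero>"
  shows "\<exists>m w. \<forall>i\<in>N. w i \<in> carrier B \<and> e i \<otimes> w i \<in> G m \<and>
    (\<forall>z\<in>carrier B. e i \<otimes> w i \<otimes> z = \<zero> \<longrightarrow> e i \<otimes> z = \<zero>)"
proof -
  have uh: "u \<in> homogeneous_elements G" "u \<noteq> \<zero>"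
    by (rule gr_uniform_homogeneous[OF u], rule gr_uniform_nonzero[OF u])
  have eh: "e i \<in> homogeneous_elements G" "e i \<noteq> \<zero>" if "i \<in> N" for i
    using gr_uniform_homogeneous gr_uniform_nonzero e(1) that by auto
  \<comment> \<open>Each \<open>e i\<close> is linked with \<open>u\<close> in both directions:
    \<open>e i \<otimes> p i\<close> acts injectively on the right ideal of \<open>u\<close>, and
    \<open>u \<otimes> q i\<close> on that of \<open>e i\<close>.\<close>
  have "\<forall>i\<in>N. \<exists>p. p \<in> homogeneous_elements G \<and> e i \<otimes> p \<otimes> u \<noteq> \<zero>"
    using homogeneous_middle_factor eh uh by blast
  then obtain p where p: "\<And>i. i \<in> N \<Longrightarrow> p i \<in> homogeneous_elements G"
    "\<And>i. i \<in> N \<Longrightarrow> e i \<otimes> p i \<otimes> u \<noteq> \<zero>" by metis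
  have "\<forall>i\<in>N. \<exists>q. q \<in> homogeneous_elements G \<and> u \<otimes> q \<otimes> e i \<noteq> \<zero>"
    using homogeneous_middle_factor eh uh by blast
  then obtain q where q: "\<And>i. i \<in> N \<Longrightarrow> q i \<in> homogeneous_elements G"
    "\<And>i. i \<in> N \<Longrightarrow> u \<otimes> q i \<otimes> e i \<noteq> \<zero>" by metis
  have "\<forall>i\<in>N. \<exists>k. e i \<otimes> p i \<in> G k"
    using eh p by (metis homogeneous_mult homogeneous_elements_def UN_E)
  then obtain \<alpha> where \<alpha>: "\<And>i. i \<in> N \<Longrightarrow> e i \<otimes> p i \<in> G (\<alpha> i)" by metis
  have "\<forall>i\<in>N. \<exists>k. u \<otimes> q i \<otimes> e i \<in> G k"
    using uh eh q by (metis homogeneous_mult homogeneous_elements_def UN_E)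
  then obtain \<beta> where \<beta>: "\<And>i. i \<in> N \<Longrightarrow> u \<otimes> q i \<otimes> e i \<in> G (\<beta> i)" by metis
  \<comment> \<open>Left multiplication by \<open>y i\<close> is a round trip from the right ideal
    of \<open>u\<close> to that of \<open>e i\<close> and back. The doubled factor
    \<open>e i\<close> does no harm because
    \<open>e i \<otimes> e i \<noteq> \<zero>\<close>.\<close>
  define y where "y i = u \<otimes> q i \<otimes> e i \<otimes> (e i \<otimes> p i)" for i
  have yG: "y i \<in> G (\<beta> i + \<alpha> i)" if "i \<in> N" for i
    unfolding y_def by (rule component_mult[OF \<beta>[OF that] \<alpha>[OF that]])
  have yu: "y i \<otimes> u \<noteq> \<zero>" if i: "i \<in> N" for i
  proof
    note c = uh(1) eh(1)[OF i] p(1)[OF i] q(1)[OF i]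
    assume "y i \<otimes> u = \<zero>"
    moreover have "y i \<otimes> u = u \<otimes> q i \<otimes> (e i \<otimes> (e i \<otimes> (p i \<otimes> u))) "
      using c by (simp add: y_def m_assoc)
    ultimately have "u \<otimes> q i \<otimes> (e i \<otimes> (e i \<otimes> (p i \<otimes> u))) = \<zero>" by simp
    then have "e i \<otimes> (e i \<otimes> (p i \<otimes> u)) = \<zero>"
      by - (rule gr_uniform_cancel[OF e(1)[OF i] _ q(2)[OF i]]; use c in auto)
    then have "e i \<otimes> (p i \<otimes> u) = \<zero>"
      by - (rule gr_uniform_cancel[OF e(1)[OF i] _ e(2)[OF i]]; use c in auto)
    with p(2)[OF i] c show False by (simp add: m_assoc)
  qed
  have yt: "\<exists>t\<in>carrier B. y i = u \<otimes> t" if i: "i \<in> N" for i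
    by (rule bexI[of _ "q i \<otimes> e i \<otimes> (e i \<otimes> p i)"])
      (use uh(1) eh(1)[OF i] p(1)[OF i] q(1)[OF i] in \<open>auto simp: y_def m_assoc\<close>)
  have yh: "y i \<in> homogeneous_elements G" if "i \<in> N" for i
    by (rule homogeneous_elementsI[OF yG[OF that]])
  \<comment> \<open>\<open>x\<close> is a product of the \<open>y i\<close> with
    \<open>i \<in> F\<close>. The equation \<open>x \<otimes> u = u \<otimes> t\<close> with
    non-zero value records that it maps the right ideal of \<open>u\<close> injectively into
    itself.\<close>
  have ex: "\<exists>x\<in>G (\<Sum>i\<in>F. \<beta> i + \<alpha> i). \<exists>t\<in>carrier B. x \<otimes> u = u \<otimes> t \<and> u \<otimes> t \<noteq> \<zero>"
    if "finite F" "F \<subseteq> N" for F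
    using that
  proof (induction F)
    case empty
    then show ?case
      using uh one_degree_zero by (intro bexI[of _ \<one>]) auto
  next
    case (insert i F)
    then obtain x t where x: "x \<in> G (\<Sum>i\<in>F. \<beta> i + \<alpha> i)" and t: "t \<in> carrier B"
      and xu: "x \<otimes> u = u \<otimes> t" "u \<otimes> t \<noteq> \<zero>" by auto
    have i: "i \<in> N" using insert.prems by simp
    obtain t' where t': "t' \<in> carrier B" "y i = u \<otimes> t'" using yt[OF i] by auto
    have c: "u \<in> carrier B" "x \<in> carrier B" "y i \<in> carrier B"
      using uh component_closed[OF x] yh[OF i] by auto
    have yxu: "y i \<otimes> x \<otimes> u = y i \<otimes> (u \<otimes> t)" using c by (simp add: m_assoc xu)
    also have "\<dots> = u \<otimes> (t' \<otimes> (u \<otimes> t))" using c t t' by (simp add: m_assoc)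
    finally have "y i \<otimes> x \<otimes> u = u \<otimes> (t' \<otimes> (u \<otimes> t))" .
    moreover have "y i \<otimes> x \<otimes> u \<noteq> \<zero>"
      using gr_uniform_cancel[OF u yh[OF i] yu[OF i] t] yxu xu(2) by auto
    moreover have "y i \<otimes> x \<in> G (\<Sum>i\<in>insert i F. \<beta> i + \<alpha> i)"
      using component_mult[OF yG[OF i] x] insert.hyps by (simp add: sum.distrib ac_simps)
    ultimately show ?case using t t' c by (intro bexI[of _ "y i \<otimes> x"] bexI[of _ "t' \<otimes> (u \<otimes> t)"]) auto
  qed
  have "\<exists>w. w \<in> carrier B \<and> e i \<otimes> w \<in> G (\<Sum>i\<in>N. \<beta> i + \<alpha> i) \<and>
      (\<forall>z\<in>carrier B. e i \<otimes> w \<otimes> z = \<zero> \<longrightarrow> e i \<otimes> z = \<zero>)" if i: "i \<in> N" for i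
  proof -
    obtain x t where x: "x \<in> G (\<Sum>j\<in>N - {i}. \<beta> j + \<alpha> j)" and t: "t \<in> carrier B"
      and xu: "x \<otimes> u = u \<otimes> t" "u \<otimes> t \<noteq> \<zero>" using ex[of "N - {i}"] N by auto
    note c = uh(1) eh(1)[OF i] p(1)[OF i] q(1)[OF i] component_closed[OF x]
    \<comment> \<open>The two legs of index \<open>i\<close> enclose the round trips of all other
      indices, so the degree of \<open>e i \<otimes> w\<close> is the full sum over
      \<open>N\<close>.\<close>
    define w where "w = p i \<otimes> (x \<otimes> (u \<otimes> q i \<otimes> e i))"
    have "e i \<otimes> w = e i \<otimes> p i \<otimes> (x \<otimes> (u \<otimes> q i \<otimes> e i))"
      using c by (simp add: w_def m_assoc)
    also have "\<dots> \<in> G (\<alpha> i + ((\<Sum>j\<in>N - {i}. \<beta> j + \<alpha> j) + \<beta> i))"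
      by (intro component_mult x \<alpha> \<beta> i)
    finally have ew: "e i \<otimes> w \<in> G (\<Sum>i\<in>N. \<beta> i + \<alpha> i)"
      using sum.remove[OF N i, of "\<lambda>i. \<beta> i + \<alpha> i"] by (simp add: ac_simps)
    have "e i \<otimes> z = \<zero>" if z: "z \<in> carrier B" and ewz: "e i \<otimes> w \<otimes> z = \<zero>" for z
    proof -
      \<comment> \<open>Replacing \<open>x \<otimes> u\<close> by \<open>u \<otimes> t\<close> puts
        what follows \<open>e i \<otimes> p i\<close> into the right ideal of \<open>u\<close>,
        where cancellation applies; then \<open>x\<close> and \<open>u \<otimes> q i\<close> are
        cancelled in turn.\<close>
      have xuz: "x \<otimes> (u \<otimes> (q i \<otimes> (e i \<otimes> z))) = u \<otimes> (t \<otimes> (q i \<otimes> (e i \<otimes> z)))"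
        using c z t xu(1) by (simp add: m_assoc[symmetric])
      have "e i \<otimes> w \<otimes> z = e i \<otimes> p i \<otimes> (x \<otimes> (u \<otimes> (q i \<otimes> (e i \<otimes> z))))"
        using c z by (simp add: w_def m_assoc)
      with ewz have "e i \<otimes> p i \<otimes> (u \<otimes> (t \<otimes> (q i \<otimes> (e i \<otimes> z)))) = \<zero>"
        by (simp add: xuz)
      then have "u \<otimes> (t \<otimes> (q i \<otimes> (e i \<otimes> z))) = \<zero>"
        by - (rule gr_uniform_cancel[OF u _ p(2)[OF i]]; use c t z in auto)
      then have "u \<otimes> (q i \<otimes> (e i \<otimes> z)) = \<zero>"
        by - (rule gr_uniform_cancel[OF u homogeneous_elementsI[OF x]]; use c z xu xuz in auto)
      then have "u \<otimes> q i \<otimes> (e i \<otimes> z) = \<zero>"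
        using c z by (simp add: m_assoc)
      then show ?thesis
        by - (rule gr_uniform_cancel[OF e(1)[OF i] _ q(2)[OF i]]; use c z in auto)
    qed
    moreover have "w \<in> carrier B" using c by (simp add: w_def)
    ultimately show ?thesis using ew by blast
  qed
  then have "\<forall>i\<in>N. \<exists>w. w \<in> carrier B \<and> e i \<otimes> w \<in> G (\<Sum>i\<in>N. \<beta> i + \<alpha> i) \<and>
      (\<forall>z\<in>carrier B. e i \<otimes> w \<otimes> z = \<zero> \<longrightarrow> e i \<otimes> z = \<zero>)" by blast
  from bchoice[OF this] show ?thesis by blast
qed


section \<open>Homogeneous regular elements in graded ideals\<close>

text \<open>The right ideal of \<open>s\<close> is gr-essential: if it met that of a homogeneous
  \<open>b \<noteq> \<zero>\<close> trivially, the elements \<open>s [^] k \<otimes> b\<close> would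
  form an infinite triangular family. So each component of \<open>z\<close>, having \<open>s\<close>
  in its right annihilator, vanishes by nonsingularity.\<close>

lemma right_regular_imp_left_regular:
  assumes s: "s \<in> homogeneous_elements G"
    and reg: "\<And>z. z \<in> carrier B \<Longrightarrow> s \<otimes> z = \<zero> \<Longrightarrow> z = \<zero>"
    and z: "z \<in> carrier B" and zs: "z \<otimes> s = \<zero>"
  shows "z = \<zero>"
proof (rule zero_if_hcomp_zero[OF z])
  fix n
  define y where "y = hcomp B G n z"
  have y: "y \<in> homogeneous_elements G" "y \<otimes> s = \<zero>"
    using z hcomp_mult_right_zero[OF s z zs] by (auto simp: y_def)
  show "hcomp B G n z = \<zero>"
    unfolding y_def[symmetric]
  proof (rule right_gr_nonsingular[OF y(1)])
    fix b assume b: "b \<in> homogeneous_elements G" "b \<noteq> \<zero>"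
    show "\<exists>t\<in>homogeneous_elements G. b \<otimes> t \<noteq> \<zero> \<and> y \<otimes> (b \<otimes> t) = \<zero>"
    proof (rule ccontr)
      assume no: "\<not> ?thesis"
      have hom: "b \<otimes> r = \<zero>"
        if r: "r \<in> homogeneous_elements G" "t \<in> homogeneous_elements G" "b \<otimes> r = s \<otimes> t" for r t
      proof -
        have "y \<otimes> (b \<otimes> r) = y \<otimes> s \<otimes> t"
          using r s y(1) by (simp add: m_assoc)
        with no r y s show ?thesis by auto
      qed
      have triv: "b \<otimes> r = \<zero>" if "r \<in> carrier B" "t \<in> carrier B" "b \<otimes> r = s \<otimes> t" for r t
        using principal_right_ideals_meet_trivially[OF b(1) s hom that] .
      have pow: "s [^] (k::nat) \<in> homogeneous_elements G" for k
        by (induction k) (use s in auto)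
      have cancel: "a = \<zero>" if "a \<in> carrier B" "s [^] (k::nat) \<otimes> a = \<zero>" for a k
        using that
      proof (induction k arbitrary: a)
        case (Suc k)
        have "s [^] k \<otimes> (s \<otimes> a) = \<zero>" using Suc.prems s by (simp add: m_assoc)
        then have "s \<otimes> a = \<zero>" using Suc.IH[of "s \<otimes> a"] Suc.prems(1) s by simp
        then show ?case using reg Suc.prems(1) by simp
      qed simp
      show False
      proof (rule no_infinite_triangular_family[of "\<lambda>k. s [^] k \<otimes> b"
            "\<lambda>k. (\<otimes>) (s [^] k) ` carrier B"])
        fix k :: nat
        show "s [^] k \<otimes> b \<in> homogeneous_elements G" using pow b by simp
        show "s [^] k \<otimes> b \<noteq> \<zero>" using cancel b by auto
        show "additive_subgroup ((\<otimes>) (s [^] k) ` carrier B) B"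
          using principal_graded_right_ideal[OF pow] by (auto simp: graded_right_ideal_def)
        show "s [^] k \<otimes> b \<otimes> r \<in> (\<otimes>) (s [^] k) ` carrier B" if "r \<in> carrier B" for r
          using s b that by (auto simp: m_assoc)
        show "(\<otimes>) (s [^] Suc k) ` carrier B \<subseteq> (\<otimes>) (s [^] k) ` carrier B"
          using s by (auto simp: m_assoc)
        fix r assume r: "r \<in> carrier B" "s [^] k \<otimes> b \<otimes> r \<in> (\<otimes>) (s [^] Suc k) ` carrier B"
        then obtain t where t: "t \<in> carrier B" "s [^] k \<otimes> b \<otimes> r = s [^] Suc k \<otimes> t" by auto
        have c: "s \<in> carrier B" "b \<in> carrier B" using s b by auto
        \<comment> \<open>Cancelling \<open>s [^] k\<close> leaves
          \<open>b \<otimes> r = s \<otimes> t\<close>, an element of both right ideals.\<close>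
        have "s [^] k \<otimes> (b \<otimes> r \<ominus> s \<otimes> t) = s [^] k \<otimes> b \<otimes> r \<ominus> s [^] Suc k \<otimes> t"
          using c r t(1) by (simp add: minus_eq r_distr r_minus m_assoc)
        also have "\<dots> = \<zero>" using t c by (simp add: minus_eq r_neg)
        finally have "b \<otimes> r \<ominus> s \<otimes> t = \<zero>"
          using cancel[of "b \<otimes> r \<ominus> s \<otimes> t" k] c r t(1) by simp
        then have "b \<otimes> r = s \<otimes> t" using c r t(1) by simp
        then have "b \<otimes> r = \<zero>" by (rule triv[OF r(1) t(1)])
        then show "s [^] k \<otimes> b \<otimes> r = \<zero>" using c r by (simp add: m_assoc)
      qed
    qed
  qed
qed

theorem graded_ideal_contains_homogeneous_regular:
  assumes I: "graded_ideal B G I" "I \<noteq> {\<zero>}"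
  shows "\<exists>s\<in>I. s \<in> homogeneous_regular B G"
proof -
  interpret I: ideal I B using I(1) by (simp add: graded_ideal_def)
  obtain a where a: "a \<in> I" "a \<noteq> \<zero>" using I(2) I.zero_closed by auto
  then obtain n where n: "hcomp B G n a \<noteq> \<zero>" using zero_if_hcomp_zero I.Icarr by blast
  define v where "v = hcomp B G n a"
  have v: "v \<in> I" "v \<in> homogeneous_elements G" "v \<noteq> \<zero>"
    using n a hcomp_in_graded_subset[of I a n] I.a_subset I(1) by (auto simp: v_def graded_ideal_def)
  \<comment> \<open>\<open>u\<close> is the pivot for equalising degrees; any uniform element would
    do.\<close>
  obtain u where u: "gr_uniform u" using ex_gr_uniform_multiple[OF v(2,3)] by auto
  define good where "good x \<longleftrightarrow> x \<in> I \<and> gr_uniform x \<and> x \<otimes> x \<noteq> \<zero>" for x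
  \<comment> \<open>While a good element annihilated by the earlier \<open>f i\<close> exists, one
    is chosen; otherwise the value is zero. Good elements are non-zero, so the first zero marks the
    end of the construction.\<close>
  define P where "P f k x \<longleftrightarrow> (if \<exists>x. good x \<and> (\<forall>i<k. f i \<otimes> x = \<zero>)
    then good x \<and> (\<forall>i<k. f i \<otimes> x = \<zero>) else x = \<zero>)" for f :: "nat \<Rightarrow> 'a" and k x
  have "\<exists>e. \<forall>k. P e k (e k)"
  \<comment> \<open>The rule requires \<open>P f k\<close> to depend only on the values of
    \<open>f\<close> below \<open>k\<close>.\<close>
  proof (rule dependent_wellorder_choice)
    fix r k and f g :: "nat \<Rightarrow> 'a"
    assume "\<And>i. i < k \<Longrightarrow> f i = g i"
    then have "(\<forall>i<k. f i \<otimes> x = \<zero>) \<longleftrightarrow> (\<forall>i<k. g i \<otimes> x = \<zero>)" for x by simp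
    then show "P f k r = P g k r" by (simp only: P_def)
  next
    show "\<exists>r. P f k r" for k f by (cases "\<exists>x. good x \<and> (\<forall>i<k. f i \<otimes> x = \<zero>)") (auto simp: P_def)
  qed
  then obtain e where e: "\<And>k. P e k (e k)" by auto
  have e_cases: "good (e k) \<or> e k = \<zero>" for k using e[of k] by (auto simp: P_def split: if_splits)
  have good_carrier: "x \<in> carrier B" if "good x" for x
    using that I.Icarr by (simp add: good_def)
  have ec: "e k \<in> carrier B" for k using e_cases[of k] good_carrier by auto
  have ee: "e i \<otimes> e k = \<zero>" if "i < k" for i k
    using e[of k] that ec[of i] by (auto simp: P_def split: if_splits)
  \<comment> \<open>With common right annihilators as \<open>V\<close>, the triangular condition
    says that \<open>e k \<otimes> (e k \<otimes> r) = \<zero>\<close> forces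
    \<open>e k \<otimes> r = \<zero>\<close>, which is cancellation for a uniform element with
    non-zero square.\<close>
  define V where "V k = {b \<in> carrier B. \<forall>i<k. e i \<otimes> b = \<zero>}" for k
  have V: "additive_subgroup (V k) B" for k
    by (rule additive_subgroupI) (use ec in \<open>auto simp: V_def r_distr r_minus\<close>)
  have eV: "e k \<otimes> r \<in> V k" if "r \<in> carrier B" for k r
    using that ec ee[of _ k] by (auto simp: V_def m_assoc[symmetric])
  have dec: "V (Suc k) \<subseteq> V k" for k by (auto simp: V_def)
  have zero: "e k \<otimes> r = \<zero>" if r: "r \<in> carrier B" "e k \<otimes> r \<in> V (Suc k)" for k r
  proof (cases "e k = \<zero>")
    case False
    then have "gr_uniform (e k)" "e k \<otimes> e k \<noteq> \<zero>" using e_cases[of k] by (auto simp: good_def)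
    then show ?thesis
      using gr_uniform_cancel[of "e k" "e k" r] gr_uniform_homogeneous r by (auto simp: V_def)
  qed (use r in simp)
  have "\<exists>k. e k = \<zero>"
  proof (rule ccontr)
    assume "\<not> ?thesis"
    then have nz: "e k \<noteq> \<zero>" for k by simp
    have eh: "e k \<in> homogeneous_elements G" for k
      using nz e_cases[of k] gr_uniform_homogeneous by (auto simp: good_def)
    show False by (rule no_infinite_triangular_family[of e V, OF eh nz V eV dec zero])
  qed
  then obtain N where N: "e N = \<zero>" "\<And>i. i < N \<Longrightarrow> e i \<noteq> \<zero>"
    using exists_least_iff[of "\<lambda>k. e k = \<zero>"] by auto
  have eg: "good (e i)" if "i < N" for i using N(2)[OF that] e_cases[of i] by simp
  \<comment> \<open>A non-zero \<open>b\<close> of this kind would have a good multiple annihilated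
    by all earlier \<open>e i\<close>, against \<open>e N = \<zero>\<close>.\<close>
  have maximal: "b = \<zero>"
    if b: "b \<in> homogeneous_elements G" "b \<in> I" "\<And>i. i < N \<Longrightarrow> e i \<otimes> b = \<zero>" for b
  proof (rule ccontr)
    assume "b \<noteq> \<zero>"
    then obtain t where t: "t \<in> homogeneous_elements G" "gr_uniform (b \<otimes> t)"
      "b \<otimes> t \<otimes> (b \<otimes> t) \<noteq> \<zero>" using ex_gr_uniform_square_nonzero[OF b(1)] by auto
    then have "good (b \<otimes> t)" using b I.I_r_closed by (simp add: good_def)
    moreover have "\<forall>i<N. e i \<otimes> (b \<otimes> t) = \<zero>"
      using b t ec by (simp add: m_assoc[symmetric])
    ultimately have "good (e N)" using e[of N] by (auto simp: P_def split: if_splits)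
    with N(1) gr_uniform_nonzero show False by (auto simp: good_def)
  qed
  have "\<exists>m w. \<forall>i\<in>{..<N}. w i \<in> carrier B \<and> e i \<otimes> w i \<in> G m \<and>
      (\<forall>z\<in>carrier B. e i \<otimes> w i \<otimes> z = \<zero> \<longrightarrow> e i \<otimes> z = \<zero>)"
    by (rule ex_multiples_of_equal_degree[OF u]) (use eg in \<open>auto simp: good_def\<close>)
  then obtain m w where mw: "\<forall>i\<in>{..<N}. w i \<in> carrier B \<and> e i \<otimes> w i \<in> G m \<and>
      (\<forall>z\<in>carrier B. e i \<otimes> w i \<otimes> z = \<zero> \<longrightarrow> e i \<otimes> z = \<zero>)"
    by (elim exE)
  have w: "w i \<in> carrier B" "e i \<otimes> w i \<in> G m" if "i < N" for i
    using mw that by simp_all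
  have cancel: "e i \<otimes> z = \<zero>" if "i < N" "z \<in> carrier B" "e i \<otimes> w i \<otimes> z = \<zero>" for i z
    using mw that by simp
  define s where "s = (\<Oplus>i\<in>{..<N}. e i \<otimes> w i)"
  have sG: "s \<in> G m"
    unfolding s_def by (rule finsum_in_additive_subgroup[OF component_subgroup]) (use w in auto)
  then have sh: "s \<in> homogeneous_elements G" and sc: "s \<in> carrier B"
    by (auto intro: homogeneous_elementsI component_closed)
  have sI: "s \<in> I"
    unfolding s_def
    by (rule finsum_in_additive_subgroup[OF I.additive_subgroup_axioms])
      (use eg w I.I_r_closed in \<open>auto simp: good_def\<close>)
  have ez: "e i \<otimes> z = \<zero>" if z: "z \<in> carrier B" "s \<otimes> z = \<zero>" and i: "i < N" for i z
  proof -
    \<comment> \<open>With this bracketing the independence of the \<open>e i\<close> applies to the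
      vanishing sum \<open>s \<otimes> z\<close>.\<close>
    have "(\<Oplus>i\<in>{..<N}. e i \<otimes> (w i \<otimes> z)) = (\<Oplus>i\<in>{..<N}. e i \<otimes> w i \<otimes> z)"
      by (rule finsum_cong') (use ec w z in \<open>auto simp: m_assoc\<close>)
    also have "\<dots> = s \<otimes> z"
      unfolding s_def by (rule finsum_ldistr[symmetric]) (use ec w z in auto)
    finally have "\<forall>i\<in>{..<N}. e i \<otimes> (w i \<otimes> z) = \<zero>"
      by (intro triangular_independent[of e V, OF ec V eV dec zero]) (use w z in auto)
    then show ?thesis using cancel[OF i z(1)] i ec w z by (simp add: m_assoc)
  qed
  have hom: "z = \<zero>" if z: "z \<in> homogeneous_elements G" "s \<otimes> z = \<zero>" for z
  proof (rule ccontr)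
    assume "z \<noteq> \<zero>"
    \<comment> \<open>Maximality concerns elements of \<open>I\<close>, but \<open>z\<close> is
      arbitrary; primeness and the fixed \<open>v \<in> I\<close> turn it into a non-zero element of
      \<open>I\<close> still killed by \<open>s\<close>.\<close>
    then obtain r where r: "r \<in> homogeneous_elements G" "z \<otimes> r \<otimes> v \<noteq> \<zero>"
      using homogeneous_middle_factor[OF z(1) _ v(2,3)] by auto
    have "z \<otimes> r \<otimes> v = \<zero>"
    proof (rule maximal)
      show "z \<otimes> r \<otimes> v \<in> I" using v(1) z r by (intro I.I_l_closed) auto
      show "e i \<otimes> (z \<otimes> r \<otimes> v) = \<zero>" if "i < N" for i
        using ez[OF _ z(2) that] ec z(1) r(1) v(2) by (simp add: m_assoc[symmetric])
    qed (use z r v in auto)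
    with r show False by simp
  qed
  have reg: "z = \<zero>" if z: "z \<in> carrier B" "s \<otimes> z = \<zero>" for z
  proof (rule zero_if_hcomp_zero[OF z(1)])
    show "hcomp B G n z = \<zero>" for n
      by (rule hom) (use z hcomp_mult_left_zero[OF sh z] in auto)
  qed
  have "regular_element B s"
    unfolding regular_element_def
    using sc reg right_regular_imp_left_regular[OF sh reg] by blast
  with sI sh show ?thesis by (auto simp: homogeneous_regular_def)
qed

end

section \<open>The ring of cocycles\<close>

context dg_algebra
begin

lemma d_zero [simp]: "d \<zero> = \<zero>"
  using d_add[of \<zero> \<zero>] d_closed[of \<zero>] by simp

lemma d_uminus:
  assumes "a \<in> carrier A"
  shows "d (\<ominus> a) = \<ominus> d a"
proof -
  have "d (\<ominus> a) \<oplus> d a = \<zero>" using d_add[of "\<ominus> a" a] assms by (simp add: l_neg)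
  then show ?thesis using assms d_closed by (simp add: minus_equality)
qed

lemma d_one: "d \<one> = \<zero>"
proof -
  have "d \<one> = d \<one> \<oplus> d \<one>"
    using leibniz[OF one_degree_zero one_closed] d_closed[of \<one>] by (simp add: koszul_sign_def)
  then show ?thesis using d_closed[of \<one>] by simp
qed

lemma hcomp_d: "a \<in> carrier A \<Longrightarrow> hcomp A G (n + 1) (d a) = d (hcomp A G n a)"
  by (rule hcomp_additive_map[OF graded_ring_axioms graded_ring_axioms])
    (auto simp: d_closed d_add d_degree)

text \<open>\<open>leibniz\<close> asks for a homogeneous left factor because of its sign. For
  \<open>d b = \<zero>\<close> the signed term disappears, and the remaining identity is additive in
  \<open>a\<close>.\<close>

lemma d_mult_cocycle_right:
  assumes a: "a \<in> carrier A" and b: "b \<in> carrier A" "d b = \<zero>"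
  shows "d (a \<otimes> b) = d a \<otimes> b"
proof -
  have "a \<in> {a \<in> carrier A. d (a \<otimes> b) = d a \<otimes> b}"
  proof (rule in_additive_subgroup_if_hcomp)
    show "additive_subgroup {a \<in> carrier A. d (a \<otimes> b) = d a \<otimes> b} A"
      by (rule additive_subgroupI)
        (use b in \<open>auto simp: d_add d_closed l_distr d_uminus l_minus\<close>)
    show "hcomp A G n a \<in> {a \<in> carrier A. d (a \<otimes> b) = d a \<otimes> b}" for n
      using leibniz[OF hcomp_component[OF a] b(1), of n] a b d_closed
      by (simp add: koszul_sign_def)
  qed (use a in simp)
  then show ?thesis by simp
qed

lemma cocyclesI: "a \<in> carrier A \<Longrightarrow> d a = \<zero> \<Longrightarrow> a \<in> cocycles A d"
  and cocycles_closed: "a \<in> cocycles A d \<Longrightarrow> a \<in> carrier A"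
  and d_cocycle: "a \<in> cocycles A d \<Longrightarrow> d a = \<zero>"
  by (auto simp: cocycles_def)

lemma d_in_cocycles: "a \<in> carrier A \<Longrightarrow> d a \<in> cocycles A d"
  by (simp add: cocyclesI d_closed d_d)

lemma uminus_in_cocycles: "a \<in> cocycles A d \<Longrightarrow> \<ominus> a \<in> cocycles A d"
  by (simp add: cocycles_def d_uminus)

lemma add_in_cocycles:
  "a \<in> cocycles A d \<Longrightarrow> b \<in> cocycles A d \<Longrightarrow> a \<oplus> b \<in> cocycles A d"
  by (simp add: cocycles_def d_add)

lemma mult_in_cocycles:
  "a \<in> cocycles A d \<Longrightarrow> b \<in> cocycles A d \<Longrightarrow> a \<otimes> b \<in> cocycles A d"
  by (simp add: cocycles_def d_mult_cocycle_right)

lemma hcomp_in_cocycles: "a \<in> cocycles A d \<Longrightarrow> hcomp A G n a \<in> cocycles A d"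
  using hcomp_d[of a n] by (auto simp: cocycles_def)

section \<open>The cocycles as a graded ring\<close>

lemma subring_cocycles: "subring (cocycles A d) A"
  by (rule subringI)
    (auto simp: cocycles_def d_one d_uminus d_add d_mult_cocycle_right d_closed)

lemma ring_cocycle_ring: "ring (cocycle_ring A d)"
  unfolding cocycle_ring_def by (rule subring_is_ring[OF subring_cocycles])

lemma cocycle_ring_simps [simp]:
  "carrier (cocycle_ring A d) = cocycles A d"
  "a \<otimes>\<^bsub>cocycle_ring A d\<^esub> b = a \<otimes> b"
  "a \<oplus>\<^bsub>cocycle_ring A d\<^esub> b = a \<oplus> b"
  "\<zero>\<^bsub>cocycle_ring A d\<^esub> = \<zero>"
  "\<one>\<^bsub>cocycle_ring A d\<^esub> = \<one>"
  by (simp_all add: cocycle_ring_def)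

text \<open>Additive inverses depend on the carrier; uniqueness of the inverse compares the
  two.\<close>

lemma uminus_cocycle_ring:
  assumes "a \<in> cocycles A d"
  shows "\<ominus>\<^bsub>cocycle_ring A d\<^esub> a = \<ominus> a"
proof -
  interpret Z: ring "cocycle_ring A d" by (rule ring_cocycle_ring)
  show ?thesis
    using Z.minus_equality[of "\<ominus> a" a] assms uminus_in_cocycles[OF assms]
    by (simp add: cocycles_closed l_neg)
qed

text \<open>Sums depend on the carrier too; the additive inclusion map carries one to the
  other.\<close>

lemma finsum_cocycle_ring:
  assumes "finite F" "x \<in> F \<rightarrow> cocycles A d"
  shows "finsum (cocycle_ring A d) x F = finsum A x F"
  using finsum_additive_map[OF ring_cocycle_ring ring_axioms, of "\<lambda>a. a" F x] assms
  by (auto simp: cocycles_closed)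

lemma homogeneous_decomposition_cocycle_ring:
  "homogeneous_decomposition (cocycle_ring A d) (cocycle_grading A G d) x a \<longleftrightarrow>
    homogeneous_decomposition A G x a \<and> (\<forall>n. x n \<in> cocycles A d)"
  by (auto simp: homogeneous_decomposition_def cocycle_grading_def finsum_cocycle_ring Pi_iff)

text \<open>Since \<open>d\<close> shifts components by one, the components of a cocycle are
  cocycles; uniqueness is inherited from \<open>A\<close>.\<close>

lemma graded_ring_cocycle_ring: "graded_ring (cocycle_ring A d) (cocycle_grading A G d)"
proof -
  interpret Z: ring "cocycle_ring A d" by (rule ring_cocycle_ring)
  show ?thesis
  proof (intro graded_ring.intro graded_ring_axioms.intro)
    fix n
    interpret G: additive_subgroup "G n" A by (rule component_subgroup)
    show "additive_subgroup (cocycle_grading A G d n) (cocycle_ring A d)"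
    proof (rule Z.additive_subgroupI)
      fix a assume "a \<in> cocycle_grading A G d n"
      then have a: "a \<in> G n" "a \<in> cocycles A d" by (simp_all add: cocycle_grading_def)
      have "\<ominus> a \<in> G n" by (rule additive_subgroup_uminus[OF component_subgroup a(1)])
      then show "\<ominus>\<^bsub>cocycle_ring A d\<^esub> a \<in> cocycle_grading A G d n"
        using a(2) by (simp add: cocycle_grading_def uminus_cocycle_ring uminus_in_cocycles)
    next
      fix a b assume "a \<in> cocycle_grading A G d n" "b \<in> cocycle_grading A G d n"
      then have "a \<in> G n" "b \<in> G n" "a \<in> cocycles A d" "b \<in> cocycles A d"
        by (simp_all add: cocycle_grading_def)
      then show "a \<oplus>\<^bsub>cocycle_ring A d\<^esub> b \<in> cocycle_grading A G d n"
        using G.a_closed by (simp add: cocycle_grading_def add_in_cocycles)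
    next
      show "cocycle_grading A G d n \<subseteq> carrier (cocycle_ring A d)"
        by (simp add: cocycle_grading_def)
      show "\<zero>\<^bsub>cocycle_ring A d\<^esub> \<in> cocycle_grading A G d n"
        by (simp add: cocycle_grading_def cocycles_def)
    qed
  next
    fix a assume "a \<in> carrier (cocycle_ring A d)"
    then have a: "a \<in> cocycles A d" "a \<in> carrier A" by (auto simp: cocycles_closed)
    show "\<exists>!x. homogeneous_decomposition (cocycle_ring A d) (cocycle_grading A G d) x a"
    proof (rule ex1I)
      show "homogeneous_decomposition (cocycle_ring A d) (cocycle_grading A G d)
          (\<lambda>n. hcomp A G n a) a"
        using hcomp_decomposition[OF a(2)] hcomp_in_cocycles[OF a(1)]
        by (simp add: homogeneous_decomposition_cocycle_ring)
      show "x = (\<lambda>n. hcomp A G n a)"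
        if "homogeneous_decomposition (cocycle_ring A d) (cocycle_grading A G d) x a" for x
        using that hcomp_eqI[OF a(2)] by (auto simp: homogeneous_decomposition_cocycle_ring)
    qed
  next
    fix a b m n
    assume "a \<in> cocycle_grading A G d m" "b \<in> cocycle_grading A G d n"
    then show "a \<otimes>\<^bsub>cocycle_ring A d\<^esub> b \<in> cocycle_grading A G d (m + n)"
      by (simp add: cocycle_grading_def component_mult mult_in_cocycles)
  qed (rule ring_cocycle_ring)
qed

lemma hcomp_cocycle_ring:
  assumes "a \<in> cocycles A d"
  shows "hcomp (cocycle_ring A d) (cocycle_grading A G d) n a = hcomp A G n a"
proof -
  interpret Z: graded_ring "cocycle_ring A d" "cocycle_grading A G d"
    by (rule graded_ring_cocycle_ring)
  show ?thesis
    using hcomp_decomposition[OF cocycles_closed] hcomp_in_cocycles assms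
    by (intro Z.hcomp_eqI) (auto simp: homogeneous_decomposition_cocycle_ring)
qed

lemma homogeneous_regular_cocycle_ring_subset:
  "homogeneous_regular (cocycle_ring A d) (cocycle_grading A G d) \<subseteq> homogeneous_regular A G"
proof
  fix s assume "s \<in> homogeneous_regular (cocycle_ring A d) (cocycle_grading A G d)"
  then obtain n where s: "s \<in> G n" "s \<in> cocycles A d"
    and l: "\<And>b. b \<in> cocycles A d \<Longrightarrow> s \<otimes> b = \<zero> \<Longrightarrow> b = \<zero>"
    and r: "\<And>b. b \<in> cocycles A d \<Longrightarrow> b \<otimes> s = \<zero> \<Longrightarrow> b = \<zero>"
    by (auto simp: homogeneous_regular_def homogeneous_elements_def cocycle_grading_def
        regular_element_def)
  note sc = cocycles_closed[OF s(2)]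
  have "a = \<zero>" if a: "a \<in> carrier A" "s \<otimes> a = \<zero>" for a
  proof -
    \<comment> \<open>Of \<open>d (s \<otimes> a) = \<zero>\<close> only the signed term survives,
      as \<open>s\<close> is a cocycle.\<close>
    have "koszul_sign A n (s \<otimes> d a) = \<zero>"
      using leibniz[OF s(1) a(1)] a s(2) sc by (simp add: d_cocycle d_closed koszul_sign_def)
    then have "s \<otimes> d a = \<zero>"
      using a sc d_closed by (auto simp: koszul_sign_def split: if_splits)
    then have "d a = \<zero>" by (rule l[OF d_in_cocycles[OF a(1)]])
    then show ?thesis by (rule l[OF cocyclesI[OF a(1)] a(2)])
  qed
  \<comment> \<open>Here the arbitrary, possibly inhomogeneous element is the left factor, so the
    rule for a right cocycle factor replaces \<open>leibniz\<close>.\<close>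
  moreover have "a = \<zero>" if a: "a \<in> carrier A" "a \<otimes> s = \<zero>" for a
  proof -
    have "d a \<otimes> s = \<zero>"
      using d_mult_cocycle_right[OF a(1) sc] a(2) s(2) by (simp add: d_cocycle)
    then have "d a = \<zero>" by (rule r[OF d_in_cocycles[OF a(1)]])
    then show ?thesis by (rule r[OF cocyclesI[OF a(1)] a(2)])
  qed
  ultimately show "s \<in> homogeneous_regular A G"
    unfolding homogeneous_regular_def regular_element_def
    using homogeneous_elementsI[OF s(1)] sc by blast
qed

end

section \<open>Localisations\<close>

text \<open>The kernel consists of the elements killed by some \<open>s \<in> S\<close>, and a
  regular \<open>s\<close> kills only zero.\<close>

lemma ore_localisation_inj_on:
  assumes "ore_localisation A S B \<phi>" and reg: "\<And>s. s \<in> S \<Longrightarrow> regular_element A s"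
  shows "inj_on \<phi> (carrier A)"
proof -
  interpret ore_localisation A S B \<phi> by fact
  interpret h: ring_hom_ring A B \<phi> by (rule ring_hom_ringI2[OF A.ring_axioms B.ring_axioms hom])
  have "a_kernel A B \<phi> \<subseteq> {\<zero>\<^bsub>A\<^esub>}"
    using reg unfolding kernel regular_element_def by blast
  moreover have "\<zero>\<^bsub>A\<^esub> \<in> a_kernel A B \<phi>"
    unfolding a_kernel_def' using A.zero_closed h.hom_zero by blast
  ultimately have "a_kernel A B \<phi> = {\<zero>\<^bsub>A\<^esub>}" by blast
  then show ?thesis by (rule h.trivial_ker_imp_inj)
qed

section \<open>Contraction of dg-ideals and dg-simplicity\<close>

lemma contraction_of_dg_ideal:
  assumes "dg_algebra R A G d" "dg_localisation R A G d S B H \<delta> \<phi>" and I: "dg_ideal B H \<delta> I"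
  defines "K \<equiv> {a \<in> cocycles A d. \<phi> a \<in> I}"
  shows "graded_ideal (cocycle_ring A d) (cocycle_grading A G d) K"
    and "I \<noteq> {\<zero>\<^bsub>B\<^esub>} \<Longrightarrow> K \<noteq> {\<zero>\<^bsub>A\<^esub>}"
proof -
  interpret A: dg_algebra R A G d by fact
  interpret Z: graded_ring "cocycle_ring A d" "cocycle_grading A G d"
    by (rule A.graded_ring_cocycle_ring)
  interpret B: dg_algebra R B H \<delta> using assms(2) by (simp add: dg_localisation_def)
  interpret L: ore_localisation A S B \<phi> using assms(2) by (simp add: dg_localisation_def)
  have dg_hom: "dg_hom R A G d B H \<delta> \<phi>" using assms(2) by (simp add: dg_localisation_def)
  interpret \<phi>: ring_hom_ring A B \<phi>
    by (rule ring_hom_ringI2[OF A.ring_axioms B.ring_axioms L.hom])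
  interpret I: ideal I B using I by (simp add: dg_ideal_def graded_ideal_def)
  have \<phi>_d: "\<phi> (d a) = \<delta> (\<phi> a)" if "a \<in> carrier A" for a
    using dg_hom that by (simp add: dg_hom_def)
  have \<phi>_deg: "\<phi> a \<in> H n" if "a \<in> G n" for a n
    using dg_hom that unfolding dg_hom_def by blast
  \<comment> \<open>The natural map has degree zero and so commutes with taking components; this
    makes \<open>K\<close> graded.\<close>
  have hcomp_\<phi>: "hcomp B H n (\<phi> a) = \<phi> (hcomp A G n a)" if "a \<in> carrier A" for n a
    using hcomp_additive_map[OF A.graded_ring_axioms B.graded_ring_axioms, of \<phi> 0 a n]
      that by (simp add: \<phi>_deg)
  have Kc: "K \<subseteq> cocycles A d" by (auto simp: K_def)
  have "ideal K (cocycle_ring A d)"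
  proof (intro ideal.intro ideal_axioms.intro Z.additive_subgroupI)
    fix a assume "a \<in> K"
    then have a: "a \<in> cocycles A d" "\<phi> a \<in> I" by (simp_all add: K_def)
    have "\<ominus>\<^bsub>B\<^esub> \<phi> a \<in> I" by (rule B.additive_subgroup_uminus[OF I.additive_subgroup_axioms a(2)])
    then show "\<ominus>\<^bsub>cocycle_ring A d\<^esub> a \<in> K"
      using a(1) by (simp add: K_def A.uminus_cocycle_ring A.cocycles_closed A.uminus_in_cocycles)
  next
    fix a b assume "a \<in> K" "b \<in> K"
    then show "a \<oplus>\<^bsub>cocycle_ring A d\<^esub> b \<in> K"
      using I.a_closed by (simp add: K_def A.add_in_cocycles A.cocycles_closed)
  next
    fix a b assume "a \<in> K" "b \<in> carrier (cocycle_ring A d)"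
    then show "b \<otimes>\<^bsub>cocycle_ring A d\<^esub> a \<in> K" "a \<otimes>\<^bsub>cocycle_ring A d\<^esub> b \<in> K"
      using I.I_l_closed I.I_r_closed
      by (simp_all add: K_def A.mult_in_cocycles A.cocycles_closed)
  next
    show "\<zero>\<^bsub>cocycle_ring A d\<^esub> \<in> K" by (simp add: K_def cocycles_def)
  qed (use Kc Z.ring_axioms in simp_all)
  moreover have "graded_subset (cocycle_ring A d) (cocycle_grading A G d) K"
  proof (rule Z.graded_subsetI)
    fix a n assume a: "a \<in> K"
    then have ac: "a \<in> cocycles A d" "a \<in> carrier A" "\<phi> a \<in> I"
      by (auto simp: K_def A.cocycles_closed)
    have "hcomp B H n (\<phi> a) \<in> I"
      by (rule B.hcomp_in_graded_subset)
        (use I I.a_subset ac in \<open>auto simp: dg_ideal_def graded_ideal_def\<close>)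
    then show "hcomp (cocycle_ring A d) (cocycle_grading A G d) n a \<in> K"
      using ac by (simp add: K_def A.hcomp_cocycle_ring hcomp_\<phi> A.hcomp_in_cocycles)
  next
    show "\<zero>\<^bsub>cocycle_ring A d\<^esub> \<in> K" by (simp add: K_def cocycles_def)
  qed (use Kc in simp)
  ultimately show "graded_ideal (cocycle_ring A d) (cocycle_grading A G d) K"
    by (simp add: graded_ideal_def)
  show "K \<noteq> {\<zero>\<^bsub>A\<^esub>}" if "I \<noteq> {\<zero>\<^bsub>B\<^esub>}"
  proof -
    obtain b where b: "b \<in> I" "b \<noteq> \<zero>\<^bsub>B\<^esub>"
      using \<open>I \<noteq> {\<zero>\<^bsub>B\<^esub>}\<close> I.zero_closed by auto
    then have "b \<in> carrier B" using I.Icarr by simp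
    \<comment> \<open>Clearing the denominator \<open>\<phi> s\<close> stays inside \<open>I\<close>
      and leads to an element of the image of \<open>A\<close>.\<close>
    then obtain s a where sa: "s \<in> S" "a \<in> carrier A" "b = inv\<^bsub>B\<^esub> (\<phi> s) \<otimes>\<^bsub>B\<^esub> \<phi> a"
      using L.fractions by auto
    have u: "\<phi> s \<in> Units B" by (rule L.inverts[OF sa(1)])
    have "\<phi> s \<otimes>\<^bsub>B\<^esub> b = \<phi> a"
      using u sa by (simp add: B.m_assoc[symmetric] B.Units_closed)
    then have \<phi>a: "\<phi> a \<in> I" using I.I_l_closed[OF b(1)] u B.Units_closed by metis
    have "a \<noteq> \<zero>\<^bsub>A\<^esub>" using b(2) sa u by auto
    show ?thesis
    proof (cases "d a = \<zero>\<^bsub>A\<^esub>")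
      case True
      then have "a \<in> K" using \<phi>a sa(2) by (simp add: K_def A.cocyclesI)
      with \<open>a \<noteq> \<zero>\<^bsub>A\<^esub>\<close> show ?thesis by auto
    next
      case False
      have "d a \<in> K"
        using I \<phi>a \<phi>_d[OF sa(2)] A.d_in_cocycles[OF sa(2)] by (auto simp: K_def dg_ideal_def)
      with False show ?thesis by auto
    qed
  qed
qed

text \<open>Allowing any \<open>S\<close> that contains the homogeneous regular cocycles treats both
  sets at once: the contraction of a non-zero dg-ideal contains such a cocycle, and its image is a
  unit.\<close>

lemma dg_localisation_dg_simple:
  assumes A: "dg_algebra R A G d"
    and prime: "gr_prime (cocycle_ring A d) (cocycle_grading A G d)"
    and Goldie: "right_gr_Goldie (cocycle_ring A d) (cocycle_grading A G d)"
    and loc: "dg_localisation R A G d S B H \<delta> \<phi>"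
    and S: "homogeneous_regular (cocycle_ring A d) (cocycle_grading A G d) \<subseteq> S"
  shows "dg_simple R B H \<delta>"
proof -
  interpret A: dg_algebra R A G d by fact
  interpret Z: gr_prime_right_Goldie_ring "cocycle_ring A d" "cocycle_grading A G d"
    by (intro gr_prime_right_Goldie_ring.intro gr_prime_right_Goldie_ring_axioms.intro
        A.graded_ring_cocycle_ring prime Goldie)
  interpret L: ore_localisation A S B \<phi> using loc by (simp add: dg_localisation_def)
  have "I = carrier B" if I: "dg_ideal B H \<delta> I" "I \<noteq> {\<zero>\<^bsub>B\<^esub>}" for I
  proof -
    interpret I: ideal I B using I by (simp add: dg_ideal_def graded_ideal_def)
    obtain s where s: "\<phi> s \<in> I" "s \<in> S"
      using Z.graded_ideal_contains_homogeneous_regular[OF contraction_of_dg_ideal(1)[OF A loc I(1)]]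
        contraction_of_dg_ideal(2)[OF A loc I] S by auto
    have u: "\<phi> s \<in> Units B" by (rule L.inverts[OF s(2)])
    have "inv\<^bsub>B\<^esub> (\<phi> s) \<otimes>\<^bsub>B\<^esub> \<phi> s \<in> I"
      by (rule I.I_l_closed[OF s(1) L.B.Units_inv_closed[OF u]])
    then show ?thesis using u I.one_imp_carrier by simp
  qed
  then show ?thesis using loc by (auto simp: dg_simple_def dg_localisation_def)
qed

section \<open>Injectivity and dg-simplicity of the two localisations\<close>

theorem theorem7p4:
  fixes R :: "'r ring"
    and A :: "('r, 'a) module" and G :: "int \<Rightarrow> 'a set" and d :: "'a \<Rightarrow> 'a"
    and S_A S_ker :: "'a set"
  defines "S_A \<equiv> homogeneous_regular A G"
    and "S_ker \<equiv> homogeneous_regular (cocycle_ring A d) (cocycle_grading A G d)"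
  assumes "cring R" and "dg_algebra R A G d"
    and "gr_prime (cocycle_ring A d) (cocycle_grading A G d)"
    and "right_gr_Goldie (cocycle_ring A d) (cocycle_grading A G d)"
    and "ore_set S_A A \<or> ore_set S_ker A"
  shows "S_ker \<subseteq> S_A \<and>
    (ore_set S_A A \<longrightarrow>
      (\<forall>(B :: ('r, 'b) module) H \<delta> \<phi>. dg_localisation R A G d S_A B H \<delta> \<phi> \<longrightarrow>
         inj_on \<phi> (carrier A) \<and> dg_simple R B H \<delta>)) \<and>
    (ore_set S_ker A \<longrightarrow>
      (\<forall>(B :: ('r, 'b) module) H \<delta> \<phi>. dg_localisation R A G d S_ker B H \<delta> \<phi> \<longrightarrow>
         inj_on \<phi> (carrier A) \<and> dg_simple R B H \<delta>))"
proof -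
  have sub: "S_ker \<subseteq> S_A"
    unfolding S_ker_def S_A_def
    by (rule dg_algebra.homogeneous_regular_cocycle_ring_subset[OF assms(4)])
  \<comment> \<open>For \<open>S\<close> between \<open>S_ker\<close> and \<open>S_A\<close>, the
    lower bound yields dg-simplicity, and the upper bound makes the elements of \<open>S\<close>
    regular, which yields injectivity.\<close>
  have main: "inj_on \<phi> (carrier A) \<and> dg_simple R B H \<delta>"
    if "dg_localisation R A G d S B H \<delta> \<phi>" "S_ker \<subseteq> S" "S \<subseteq> S_A"
    for S and B :: "('r, 'b) module" and H \<delta> \<phi>
  proof
    show "inj_on \<phi> (carrier A)"
      by (rule ore_localisation_inj_on[of A S B])
        (use that in \<open>auto simp: dg_localisation_def S_A_def homogeneous_regular_def\<close>)
    show "dg_simple R B H \<delta>"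
      using dg_localisation_dg_simple[OF assms(4-6) that(1)] that(2) by (simp add: S_ker_def)
  qed
  show ?thesis
    using sub main[OF _ sub subset_refl] main[OF _ subset_refl sub] by blast
qed

end
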